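(* Let $X$ be a finite-dimensional locally continuum-connected cosmic space. Then the following conditions are equivalent: (1) $X$ admits a closed embedding into a compactly finite-dimensional topological group; (2) $X$ admits a closed embedding into $\mathbb{R}^{2n+1}$, where $n=\dim(X)$; (3) $X$ is metrizable and locally compact.
   Context: Topological groups are assumed Hausdorff. $\dim$ denotes the covering dimension; a space $X$ is finite-dimensional if $\dim(X)<\infty$. A closed embedding is a topological embedding whose image is a closed subset of the target. A topological group $G$ is called compactly finite-dimensional if $\sup\{\dim(K): K \text{ is a compact subspace of } G\}$ is finite. A continuum is a connected compact Hausdorff space. Two points $x,y$ of a topological space $X$ are connected by a subcontinuum $K\subset X$ if $x,y\in K$. A topological space $X$ is locally continuum-connected at a point $x\in X$ if for every neighborhood $U\subset X$ of $x$ there is another neighborhood $V\subset U$ of $x$ such that each point $y\in V$ can be connected with $x$ by a subcontinuum $K\subset U$. A space is locally continuum-connected if it is locally continuum-connected at each of its points. A regular topological space is cosmic if it is a continuous image of a separable metrizable space (equivalently, if it has countable network weight). *)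

theory Defs
  imports "HOL-Analysis.Analysis" "HOL-Algebra.Group"
begin

section \<open>Covering dimension\<close>

text \<open>
  The library predicate \<open>dim_le\<close> is the small inductive dimension, so the covering dimension
  (Cech--Lebesgue, via finite open covers) is introduced here. A cover has order at most \<open>n\<close>
  if no point lies in more than \<open>n + 1\<close> of its members.
\<close>

definition finite_open_cover :: "'a topology \<Rightarrow> 'a set set \<Rightarrow> bool"
  where "finite_open_cover X \<U> \<longleftrightarrow>
    finite \<U> \<and> (\<forall>U\<in>\<U>. openin X U) \<and> \<Union>\<U> = topspace X"

definition covering_dim_le :: "'a topology \<Rightarrow> nat \<Rightarrow> bool"
  where "covering_dim_le X n \<longleftrightarrow>
    (\<forall>\<U>. finite_open_cover X \<U> \<longrightarrow>
      (\<exists>\<V>. finite_open_cover X \<V> \<and> (\<forall>V\<in>\<V>. \<exists>U\<in>\<U>. V \<subseteq> U) \<and>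
           (\<forall>x\<in>topspace X. card {V\<in>\<V>. x \<in> V} \<le> n + 1)))"

text \<open>
  The value is \<open>\<infinity>\<close> if no bound exists. The empty space, often given dimension \<open>-1\<close>, has
  dimension \<open>0\<close> here.
\<close>

definition covering_dim :: "'a topology \<Rightarrow> enat"
  where "covering_dim X = Inf {enat n |n. covering_dim_le X n}"

definition finite_dimensional :: "'a topology \<Rightarrow> bool"
  where "finite_dimensional X \<longleftrightarrow> covering_dim X < \<infinity>"


section \<open>Topological groups and closed embeddings\<close>

definition topological_group :: "'g monoid \<Rightarrow> 'g topology \<Rightarrow> bool"
  where "topological_group G T \<longleftrightarrow>
    group G \<and> topspace T = carrier G \<and> Hausdorff_space T \<and>
    continuous_map (prod_topology T T) T (\<lambda>(x, y). x \<otimes>\<^bsub>G\<^esub> y) \<and>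
    continuous_map T T (\<lambda>x. inv\<^bsub>G\<^esub> x)"

definition compactly_finite_dimensional :: "'g topology \<Rightarrow> bool"
  where "compactly_finite_dimensional T \<longleftrightarrow>
    (SUP K\<in>{K. compactin T K}. covering_dim (subtopology T K)) < \<infinity>"

definition closed_embedding :: "'a topology \<Rightarrow> 'b topology \<Rightarrow> ('a \<Rightarrow> 'b) \<Rightarrow> bool"
  where "closed_embedding X Y e \<longleftrightarrow> embedding_map X Y e \<and> closedin Y (e ` topspace X)"

text \<open>
  The type argument is the universe from which the elements of the group are drawn; the group
  itself may live on any subset of that type. A group on any type containing a cosmic \<open>X\<close>
  as a closed subspace has a subgroup of cardinality at most the continuum (the one generated by
  \<open>X\<close>) that still does, so the universe \<open>nat \<Rightarrow> real\<close> represents all groups.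
\<close>

definition closed_embeds_in_cfd_group :: "'g itself \<Rightarrow> 'a topology \<Rightarrow> bool"
  where "closed_embeds_in_cfd_group _ X \<longleftrightarrow>
    (\<exists>(G :: 'g monoid) T e. topological_group G T \<and> compactly_finite_dimensional T \<and>
       closed_embedding X T e)"


section \<open>Local continuum-connectedness\<close>

definition subcontinuum :: "'a topology \<Rightarrow> 'a set \<Rightarrow> bool"
  where "subcontinuum X K \<longleftrightarrow>
    compactin X K \<and> connectedin X K \<and> Hausdorff_space (subtopology X K)"

definition locally_continuum_connected_at :: "'a topology \<Rightarrow> 'a \<Rightarrow> bool"
  where "locally_continuum_connected_at X x \<longleftrightarrow>
    (\<forall>U. openin X U \<and> x \<in> U \<longrightarrow>
      (\<exists>V. openin X V \<and> x \<in> V \<and> V \<subseteq> U \<and>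
        (\<forall>y\<in>V. \<exists>K. subcontinuum X K \<and> x \<in> K \<and> y \<in> K \<and> K \<subseteq> U)))"

definition locally_continuum_connected :: "'a topology \<Rightarrow> bool"
  where "locally_continuum_connected X \<longleftrightarrow>
    (\<forall>x\<in>topspace X. locally_continuum_connected_at X x)"


section \<open>Cosmic spaces\<close>

text \<open>
  The separable metrizable space is required to live on the same type as \<open>X\<close>. This is no
  restriction: by \<open>cosmic_spaceI\<close> below, a source space on any other type will do.
  Since \<open>regular_space\<close> does not include \<open>T\<^sub>1\<close>, neither does this notion.
\<close>

definition cosmic_space :: "'a topology \<Rightarrow> bool"
  where "cosmic_space X \<longleftrightarrow>
    regular_space X \<and>
    (\<exists>(M :: 'a topology) f. metrizable_space M \<and> separable_space M \<and>
       continuous_map M X f \<and> f ` topspace M = topspace X)"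

lemma separable_metrizable_imp_second_countable:
  assumes "metrizable_space X" "separable_space X"
  shows "second_countable X"
proof -
  obtain M d where "Metric_space M d" and X: "X = Metric_space.mtopology M d"
    using assms(1) by (auto simp: metrizable_space_def)
  then interpret Metric_space M d by simp
  obtain C where C: "countable C" "C \<subseteq> M" "mtopology closure_of C = M"
    using assms(2) by (auto simp: separable_space_def X)
  define \<B> where "\<B> = (\<lambda>(c, n). mball c (inverse (real (Suc n)))) ` (C \<times> UNIV)"
  have "\<exists>V\<in>\<B>. x \<in> V \<and> V \<subseteq> U" if U: "openin mtopology U" "x \<in> U" for U x
  proof -
    have xM: "x \<in> M" using U openin_mtopology by blast
    obtain r where r: "r > 0" "mball x r \<subseteq> U"
      using U openin_mtopology by blast
    obtain n where n: "inverse (real (Suc n)) < r / 2"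
      using reals_Archimedean [of "r / 2"] r by auto
    have "\<forall>r>0. \<exists>y\<in>C. y \<in> mball x r"
      using C(3) xM unfolding metric_closure_of by blast
    moreover have "inverse (real (Suc n)) > 0" by simp
    ultimately obtain c where c: "c \<in> C" "c \<in> mball x (inverse (real (Suc n)))"
      by blast
    then have cM: "c \<in> M" and d: "d x c < inverse (real (Suc n))" by auto
    have "mball c (inverse (real (Suc n))) \<subseteq> mball x r"
    proof
      fix z assume "z \<in> mball c (inverse (real (Suc n)))"
      then have z: "z \<in> M" "d c z < inverse (real (Suc n))" by auto
      have "d x z \<le> d x c + d c z" using triangle xM cM z by blast
      also have "\<dots> < r" using d z n by linarith
      finally show "z \<in> mball x r" using xM z by simp
    qed
    moreover have "x \<in> mball c (inverse (real (Suc n)))"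
      using d xM cM by (simp add: commute)
    ultimately show ?thesis
      using r c unfolding \<B>_def by force
  qed
  moreover have "countable \<B>" "\<forall>V\<in>\<B>. openin mtopology V"
    using C by (auto simp: \<B>_def)
  ultimately show ?thesis
    unfolding second_countable_def X by blast
qed

lemma cosmic_spaceI:
  fixes M :: "'m topology" and X :: "'a topology"
  assumes "regular_space X" "metrizable_space M" "separable_space M"
    and f: "continuous_map M X f" "f ` topspace M = topspace X"
  shows "cosmic_space X"
proof -
  define g where "g = inv_into (topspace M) f"
  define S where "S = g ` topspace X"
  have g: "g x \<in> topspace M" "f (g x) = x" if "x \<in> topspace X" for x
    using that f(2) by (auto simp: g_def inv_into_into f_inv_into_f)
  have inj: "inj_on g (topspace X)" by (metis g(2) inj_onI)
  define N where "N = pullback_topology (topspace X) g M"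
  have tN: "topspace N = topspace X"
    using g by (auto simp: N_def topspace_pullback_topology)
  have SM: "S \<subseteq> topspace M" using g by (auto simp: S_def)
  have gN: "continuous_map N (subtopology M S) g"
    using continuous_map_pullback [where f = g and g = id and A = "topspace X", OF continuous_map_id]
    by (auto simp: continuous_map_in_subtopology N_def S_def topspace_pullback_topology)
  have fN: "continuous_map (subtopology M S) N f"
  proof -
    have "continuous_map (subtopology M S) M (g \<circ> f)"
      by (rule continuous_map_eq [of _ _ id]) (use g in \<open>auto simp: S_def\<close>)
    then show ?thesis
      unfolding N_def
      by (intro continuous_map_pullback') (use g in \<open>auto simp: S_def\<close>)
  qed
  have "homeomorphic_maps (subtopology M S) N f g"
    unfolding homeomorphic_maps_def using gN fN g by (auto simp: S_def tN)
  then have hom: "subtopology M S homeomorphic_space N"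
    by (auto simp: homeomorphic_space_def)
  have "metrizable_space N"
    using homeomorphic_metrizable_space [OF hom] assms(2) metrizable_space_subtopology by blast
  moreover have "separable_space N"
    using homeomorphic_space_second_countability [OF hom] second_countable_subtopology
      separable_metrizable_imp_second_countable [OF assms(2,3)]
      second_countable_imp_separable_space by blast
  moreover have "continuous_map N X id"
  proof (rule continuous_map_eq)
    show "continuous_map N X (f \<circ> g)"
      using continuous_map_compose [OF gN continuous_map_from_subtopology [OF f(1)]] .
  qed (use g tN in auto)
  ultimately show ?thesis
    unfolding cosmic_space_def using assms(1) tN by (metis image_id id_apply)
qed

end

theory Submission
  imports Defs
begin

text \<open>
  (1) implies (3): if \<open>X\<close>, translated so that it contains the unit, is not locally compact there, then every compact
  subset of the group is escaped by arbitrarily small continua in \<open>X\<close> through the unit. Choose such continua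
  \<open>X\<^sub>0, \<dots>, X\<^sub>n\<^sub>-\<^sub>1\<close> and points \<open>b\<^sub>i \<in> X\<^sub>i\<close> one after the other, \<open>b\<^sub>i\<close> outside \<open>K\<^sup>-\<^sup>1K\<close> for
  \<open>K = X\<^sub>0\<cdots>X\<^sub>i\<^sub>-\<^sub>1\<close> and the later continua tiny. Then in the compact set \<open>X\<^sub>0\<cdots>X\<^sub>n\<^sub>-\<^sub>1\<close> the faces
  \<open>x\<^sub>i = 1\<close> and \<open>x\<^sub>i = b\<^sub>i\<close> have disjoint images for every \<open>i\<close>, and a Lebesgue covering argument forces its
  dimension to be at least \<open>n\<close>: connectedness of the \<open>X\<^sub>i\<close> yields arbitrarily fine grids, on which Kuhn's
  combinatorial lemma applies. A locally compact Hausdorff space with a countable network is second countable.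

  (3) implies (2): countably many pairs of disjoint compact sets separate the points of \<open>X\<close>. Starting from a proper
  map, one separates the images of the pairs one by one by ever smaller perturbations, using partitions of unity of
  order at most \<open>n + 1\<close> and points of \<open>\<real>\<^sup>2\<^sup>n\<^sup>+\<^sup>1\<close> in general position; the limit is proper and injective.

  (2) implies (1): grid cubes bound the dimension of all compact subsets of \<open>\<real>\<^sup>m\<close> by \<open>2\<^sup>m\<close>.
\<close>

section \<open>Compactness, connectedness and covers\<close>

lemma compactin_finite_subindex:
  assumes "compactin X K" "\<forall>i\<in>I. openin X (f i)" "K \<subseteq> (\<Union>i\<in>I. f i)"
  shows "\<exists>J. finite J \<and> J \<subseteq> I \<and> K \<subseteq> (\<Union>i\<in>J. f i)"
proof -
  have "\<forall>U\<in>f ` I. openin X U" using assms(2) by blast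
  then obtain \<F> where F: "finite \<F>" "\<F> \<subseteq> f ` I" "K \<subseteq> \<Union>\<F>"
    using assms(1,3) unfolding compactin_def by meson
  from finite_subset_image[OF F(1,2)] obtain J where "J \<subseteq> I" "finite J" "\<F> = f ` J"
    by (elim exE conjE)
  then show ?thesis using F(3) by blast
qed

text \<open>Members are replaced one at a time: normality puts an open \<open>U\<close> with closure
  inside \<open>W\<close> around the part of \<open>C\<close> that only \<open>W\<close> covers, and
  the rest \<open>C - U\<close> is closed and left to the other members.\<close>

lemma finite_cover_shrink:
  assumes X: "normal_space X" and "finite \<V>" "\<forall>V\<in>\<V>. openin X V" "closedin X C" "C \<subseteq> \<Union>\<V>"
  shows "\<exists>F. (\<forall>V\<in>\<V>. closedin X (F V) \<and> F V \<subseteq> V) \<and> C \<subseteq> (\<Union>V\<in>\<V>. F V)"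
  using assms(2-)
proof (induction \<V> arbitrary: C)
  case empty
  then show ?case by auto
next
  case (insert W \<V>)
  have "openin X (\<Union>\<V>)" using insert.prems by blast
  then have "closedin X (C - \<Union>\<V>)" using insert.prems by blast
  moreover have "openin X W" "C - \<Union>\<V> \<subseteq> W" using insert.prems by auto
  ultimately obtain U where U: "openin X U" "C - \<Union>\<V> \<subseteq> U" "X closure_of U \<subseteq> W"
    using X unfolding normal_space_alt by metis
  have "closedin X (C - U)" "C - U \<subseteq> \<Union>\<V>" using insert.prems U by auto
  then obtain F where F: "\<forall>V\<in>\<V>. closedin X (F V) \<and> F V \<subseteq> V" "C - U \<subseteq> (\<Union>V\<in>\<V>. F V)"
    using insert.IH[of "C - U"] insert.prems by blast
  have "U \<subseteq> X closure_of U"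
    using U(1) closure_of_subset openin_subset by metis
  then have "C \<subseteq> (\<Union>V\<in>insert W \<V>. (F(W := X closure_of U)) V)"
    using F(2) insert.hyps(2) by (auto split: if_splits)
  then show ?case
    using F(1) U(3) insert.hyps(2)
    by (intro exI[of _ "F(W := X closure_of U)"]) auto
qed

text \<open>Let \<open>E\<close> be the set of points reachable from \<open>a\<close>. If
  \<open>b\<close> were not in it, the members of \<open>\<U>\<close> that meet \<open>E\<close> and
  those that miss it would separate \<open>Z\<close>. Chains of every large length are provided
  because the grids below use one \<open>p\<close> in all coordinates.\<close>

lemma connectedin_chain:
  assumes Z: "connectedin T Z" and op: "\<And>U. U \<in> \<U> \<Longrightarrow> openin T U" and cov: "Z \<subseteq> \<Union>\<U>"
    and ab: "a \<in> Z" "b \<in> Z"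
  shows "\<exists>p0. \<forall>p\<ge>p0. \<exists>c::nat \<Rightarrow> 'a. c 0 = a \<and> c p = b \<and> (\<forall>j\<le>p. c j \<in> Z) \<and>
           (\<forall>j<p. \<exists>U\<in>\<U>. c j \<in> U \<and> c (Suc j) \<in> U)"
proof -
  define R where "R = {(x, y). x \<in> Z \<and> y \<in> Z \<and> (\<exists>U\<in>\<U>. x \<in> U \<and> y \<in> U)}"
  define E where "E = {y \<in> Z. (a, y) \<in> R\<^sup>*}"
  define A where "A = \<Union>{U\<in>\<U>. U \<inter> E \<noteq> {}}"
  define B where "B = \<Union>{U\<in>\<U>. U \<inter> E = {}}"
  have AE: "A \<inter> Z \<subseteq> E"
  proof
    fix z assume "z \<in> A \<inter> Z"
    then obtain U y where "U \<in> \<U>" "z \<in> U" "y \<in> U" "y \<in> E" "z \<in> Z" by (auto simp: A_def)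
    then have "(a, y) \<in> R\<^sup>*" "(y, z) \<in> R" "z \<in> Z" by (auto simp: E_def R_def)
    then show "z \<in> E" unfolding E_def using rtrancl_into_rtrancl[of a y R z] by simp
  qed
  have "openin T A" "openin T B" using op by (auto simp: A_def B_def)
  moreover have "A \<union> B = \<Union>\<U>" by (auto simp: A_def B_def)
  then have "Z \<subseteq> A \<union> B" using cov by simp
  moreover have "A \<inter> B \<inter> Z = {}" using AE by (auto simp: B_def)
  moreover have "a \<in> E" using ab by (simp add: E_def)
  then have "A \<inter> Z \<noteq> {}" using ab cov by (auto simp: A_def)
  ultimately have "B \<inter> Z = {}" using Z unfolding connectedin by blast
  then have "b \<in> E" using \<open>Z \<subseteq> A \<union> B\<close> AE ab by blast
  then obtain p0 where "(a, b) \<in> R ^^ p0" by (auto simp: E_def rtrancl_power)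
  then obtain c where c: "c 0 = a" "c p0 = b" "\<forall>j<p0. (c j, c (Suc j)) \<in> R"
    unfolding relpow_fun_conv by blast
  show ?thesis
  proof (intro exI[of _ p0] allI impI)
    fix p assume p: "p \<ge> p0"
    \<comment> \<open>Cutting the index off at \<open>p0\<close> pads the chain by repeating its end
      \<open>b\<close>.\<close>
    have inZ: "c (min j p0) \<in> Z" for j
    proof (cases "min j p0 = p0")
      case False
      then have "min j p0 < p0" by auto
      then show ?thesis using c(3) by (auto simp: R_def)
    qed (use c ab in simp)
    have "\<exists>U\<in>\<U>. c (min j p0) \<in> U \<and> c (min (Suc j) p0) \<in> U" for j
    proof (cases "j < p0")
      case True
      then show ?thesis using c(3) by (auto simp: R_def min_def)
    next
      case False
      then show ?thesis using c ab cov by (auto simp: min_def)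
    qed
    then show "\<exists>d. d 0 = a \<and> d p = b \<and> (\<forall>j\<le>p. d j \<in> Z) \<and> (\<forall>j<p. \<exists>U\<in>\<U>. d j \<in> U \<and> d (Suc j) \<in> U)"
      using inZ c p by (intro exI[of _ "\<lambda>j. c (min j p0)"]) (auto simp: min_def)
  qed
qed

text \<open>Two-sided tube lemma: compactness of \<open>K\<close> gives each \<open>z\<close> a
  neighbourhood good for all of \<open>K\<close>, compactness of \<open>Z\<close> leaves finitely
  many such tubes, and each \<open>V\<close> is then made small enough for all of them. It stands in
  for uniform continuity, so any \<open>U\<close> may be paired with any \<open>V\<close>.\<close>

lemma compactin_box_refine:
  assumes K: "compactin S K" and Z: "compactin T Z" and h: "continuous_map (prod_topology S T) Y (\<lambda>(x, y). h x y)"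
    and op: "\<And>U. U \<in> \<O> \<Longrightarrow> openin Y U"
    and cov: "\<And>k z. k \<in> K \<Longrightarrow> z \<in> Z \<Longrightarrow> h k z \<in> \<Union>\<O>"
  shows "\<exists>\<U> \<V>. (\<forall>U\<in>\<U>. openin T U) \<and> Z \<subseteq> \<Union>\<U> \<and> (\<forall>V\<in>\<V>. openin S V) \<and> K \<subseteq> \<Union>\<V> \<and>
    (\<forall>U\<in>\<U>. \<forall>V\<in>\<V>. \<exists>W\<in>\<O>. \<forall>v\<in>V. \<forall>u\<in>U. h v u \<in> W)"
proof -
  define good where "good U V \<longleftrightarrow> openin T U \<and> openin S V \<and> (\<exists>W\<in>\<O>. \<forall>v\<in>V. \<forall>u\<in>U. h v u \<in> W)" for U V
  have loc: "\<exists>U V. good U V \<and> k \<in> V \<and> z \<in> U" if kz: "k \<in> K" "z \<in> Z" for k z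
  proof -
    obtain W where W: "W \<in> \<O>" "h k z \<in> W" using cov kz by blast
    define P where "P = {p \<in> topspace (prod_topology S T). (\<lambda>(x, y). h x y) p \<in> W}"
    have "openin (prod_topology S T) P"
      unfolding P_def by (rule openin_continuous_map_preimage[OF h op[OF W(1)]])
    moreover have "(k, z) \<in> P"
      using W kz compactin_subset_topspace[OF K] compactin_subset_topspace[OF Z] by (auto simp: P_def)
    ultimately obtain V U where VU: "openin S V" "openin T U" "k \<in> V" "z \<in> U" "V \<times> U \<subseteq> P"
      by (metis openin_prod_topology_alt)
    then have "\<forall>v\<in>V. \<forall>u\<in>U. h v u \<in> W" by (auto simp: P_def)
    then have "good U V" unfolding good_def by (intro conjI VU bexI[OF _ W(1)])
    then show ?thesis using VU by (intro exI conjI)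
  qed
  have tube: "\<exists>U. openin T U \<and> z \<in> U \<and> (\<forall>k\<in>K. \<exists>V. good U V \<and> k \<in> V)" if z: "z \<in> Z" for z
  proof -
    define \<V> where "\<V> = {V. \<exists>U. good U V \<and> z \<in> U}"
    have "\<forall>V\<in>\<V>. openin S V" by (auto simp: \<V>_def good_def)
    moreover have "K \<subseteq> \<Union>\<V>"
    proof
      fix k assume "k \<in> K"
      from loc[OF this z] obtain U V where "good U V" "k \<in> V" "z \<in> U" by (elim exE conjE)
      then show "k \<in> \<Union>\<V>" unfolding \<V>_def by (intro UnionI[of V]) auto
    qed
    ultimately obtain \<F> where F: "finite \<F>" "\<F> \<subseteq> \<V>" "K \<subseteq> \<Union>\<F>"
      using K unfolding compactin_def by meson
    have "\<forall>V\<in>\<F>. \<exists>U. good U V \<and> z \<in> U" using F(2) by (auto simp: \<V>_def)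
    from bchoice[OF this] obtain u where "\<forall>V\<in>\<F>. good (u V) V \<and> z \<in> u V" by (rule exE)
    then have u: "\<And>V. V \<in> \<F> \<Longrightarrow> good (u V) V \<and> z \<in> u V" by (rule bspec)
    \<comment> \<open>\<open>topspace T\<close> takes care of empty \<open>\<F>\<close>, where the
      intersection alone would be the whole type.\<close>
    let ?U = "topspace T \<inter> \<Inter>(u ` \<F>)"
    have "openin T ?U"
    proof (cases "\<F> = {}")
      case False
      then have "openin T (\<Inter>(u ` \<F>))" using F u by (intro openin_Inter) (auto simp: good_def)
      then show ?thesis by blast
    qed auto
    moreover have "z \<in> ?U" using u z compactin_subset_topspace[OF Z] by auto
    moreover have "\<exists>V. good ?U V \<and> k \<in> V" if k: "k \<in> K" for k
    proof -
      obtain V where V: "V \<in> \<F>" "k \<in> V" using F k by blast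
      then have "good ?U V" using u[OF V(1)] \<open>openin T ?U\<close> unfolding good_def by blast
      then show ?thesis using V by blast
    qed
    ultimately show ?thesis by blast
  qed
  then obtain U where U: "\<And>z. z \<in> Z \<Longrightarrow> openin T (U z) \<and> z \<in> U z \<and> (\<forall>k\<in>K. \<exists>V. good (U z) V \<and> k \<in> V)"
    by metis
  then have "\<forall>z\<in>Z. openin T (U z)" "Z \<subseteq> (\<Union>z\<in>Z. U z)" by auto
  from compactin_finite_subindex[OF Z this] obtain D where D: "finite D" "D \<subseteq> Z" "Z \<subseteq> \<Union>(U ` D)"
    by (elim exE conjE)
  define \<V> where "\<V> = {V. openin S V \<and> (\<forall>z\<in>D. good (U z) V)}"
  have "K \<subseteq> \<Union>\<V>"
  proof
    fix k assume k: "k \<in> K"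
    then have "\<forall>z\<in>D. \<exists>V. good (U z) V \<and> k \<in> V" using U D by blast
    then obtain v where v: "\<And>z. z \<in> D \<Longrightarrow> good (U z) (v z) \<and> k \<in> v z" by metis
    let ?V = "topspace S \<inter> \<Inter>(v ` D)"
    have oV: "openin S ?V"
    proof (cases "D = {}")
      case False
      then have "openin S (\<Inter>(v ` D))" using D v by (intro openin_Inter) (auto simp: good_def)
      then show ?thesis by blast
    qed auto
    moreover have "good (U z) ?V" if "z \<in> D" for z
      using v[OF that] oV that unfolding good_def by blast
    ultimately have "?V \<in> \<V>" unfolding \<V>_def by blast
    moreover have "k \<in> ?V" using v k compactin_subset_topspace[OF K] by auto
    ultimately show "k \<in> \<Union>\<V>" by blast
  qed
  moreover have "\<forall>W\<in>U ` D. openin T W" "\<forall>V\<in>\<V>. openin S V" using U D by (auto simp: \<V>_def)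
  moreover have "\<forall>W\<in>U ` D. \<forall>V\<in>\<V>. \<exists>P\<in>\<O>. \<forall>v\<in>V. \<forall>u\<in>W. h v u \<in> P"
    by (auto simp: \<V>_def good_def)
  ultimately show ?thesis using D(3) by blast
qed

section \<open>Products of continua in a topological group\<close>

primrec iter_mult :: "('g, 'b) monoid_scheme \<Rightarrow> (nat \<Rightarrow> 'g) \<Rightarrow> nat \<Rightarrow> 'g" where
  "iter_mult G x 0 = \<one>\<^bsub>G\<^esub>"
| "iter_mult G x (Suc n) = iter_mult G x n \<otimes>\<^bsub>G\<^esub> x n"

text \<open>A face of the product is obtained by updating the family: with
  \<open>X(i := {a i})\<close> for \<open>X\<close>, this is the image of the face x_i = a_i of the
  box.\<close>

definition set_mult_prod :: "('g, 'b) monoid_scheme \<Rightarrow> (nat \<Rightarrow> 'g set) \<Rightarrow> nat \<Rightarrow> 'g set" where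
  "set_mult_prod G X n = (\<lambda>x. iter_mult G x n) ` {x. \<forall>i<n. x i \<in> X i}"

lemma iter_mult_cong: "(\<And>i. i < n \<Longrightarrow> x i = y i) \<Longrightarrow> iter_mult G x n = iter_mult G y n"
  by (induction n) auto

lemma iter_mult_in_prod: "(\<And>i. i < n \<Longrightarrow> x i \<in> X i) \<Longrightarrow> iter_mult G x n \<in> set_mult_prod G X n"
  by (auto simp: set_mult_prod_def)

lemma set_mult_prod_0 [simp]: "set_mult_prod G X 0 = {\<one>\<^bsub>G\<^esub>}"
  by (auto simp: set_mult_prod_def)

lemma set_mult_prod_Suc:
  "set_mult_prod G X (Suc n) = (\<lambda>(a, b). a \<otimes>\<^bsub>G\<^esub> b) ` (set_mult_prod G X n \<times> X n)"
proof
  show "set_mult_prod G X (Suc n) \<subseteq> (\<lambda>(a, b). a \<otimes>\<^bsub>G\<^esub> b) ` (set_mult_prod G X n \<times> X n)"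
    by (auto simp: set_mult_prod_def)
next
  show "(\<lambda>(a, b). a \<otimes>\<^bsub>G\<^esub> b) ` (set_mult_prod G X n \<times> X n) \<subseteq> set_mult_prod G X (Suc n)"
  proof clarsimp
    fix a b assume "a \<in> set_mult_prod G X n" and b: "b \<in> X n"
    then obtain x where x: "\<forall>i<n. x i \<in> X i" "a = iter_mult G x n"
      by (auto simp: set_mult_prod_def)
    have "iter_mult G (x(n := b)) n = iter_mult G x n" by (rule iter_mult_cong) auto
    then have "a \<otimes>\<^bsub>G\<^esub> b = iter_mult G (x(n := b)) (Suc n)" using x by simp
    also have "\<dots> \<in> set_mult_prod G X (Suc n)"
      using x b by (intro iter_mult_in_prod) (auto simp: less_Suc_eq)
    finally show "a \<otimes>\<^bsub>G\<^esub> b \<in> set_mult_prod G X (Suc n)" .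
  qed
qed

locale top_group = group G for G (structure) +
  fixes T :: "'a topology"
  assumes topspace_eq: "topspace T = carrier G"
    and Hausdorff: "Hausdorff_space T"
    and mult_cont: "continuous_map (prod_topology T T) T (\<lambda>(x, y). x \<otimes> y)"
    and inv_cont: "continuous_map T T (\<lambda>x. inv x)"
begin

lemma compactin_mult:
  assumes "compactin T A" "compactin T B"
  shows "compactin T ((\<lambda>(a, b). a \<otimes> b) ` (A \<times> B))"
  using image_compactin[OF _ mult_cont] assms by (simp add: compactin_Times)

lemma compactin_set_mult_prod:
  "(\<And>i. i < n \<Longrightarrow> compactin T (X i)) \<Longrightarrow> compactin T (set_mult_prod G X n)"
proof (induction n)
  case 0
  then show ?case by (simp add: topspace_eq)
next
  case (Suc n)
  then show ?case unfolding set_mult_prod_Suc by (intro compactin_mult) auto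
qed

text \<open>Induction on \<open>n\<close>: \<open>compactin_box_refine\<close>, applied to the
  multiplication, splits \<open>\<O>\<close> into a cover for the first \<open>n\<close> factors and
  one for the last; the induction hypothesis handles the former and \<open>connectedin_chain\<close>
  the latter. The chains act as the edges of a subdivided cube, each small cube going into one
  member of \<open>\<O>\<close>.\<close>

lemma iter_mult_grid:
  assumes "\<And>i. i < n \<Longrightarrow> compactin T (X i) \<and> connectedin T (X i) \<and> a i \<in> X i \<and> b i \<in> X i"
    and "\<And>W. W \<in> \<O> \<Longrightarrow> openin T W" and "set_mult_prod G X n \<subseteq> \<Union>\<O>"
  shows "\<exists>p0. \<forall>p\<ge>p0. \<exists>c::nat \<Rightarrow> nat \<Rightarrow> 'a. (\<forall>i<n. c i 0 = a i \<and> c i p = b i \<and> (\<forall>j\<le>p. c i j \<in> X i)) \<and>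
    (\<forall>q. (\<forall>i<n. q i < p) \<longrightarrow>
      (\<exists>W\<in>\<O>. \<forall>r. (\<forall>i<n. q i \<le> r i \<and> r i \<le> Suc (q i)) \<longrightarrow> iter_mult G (\<lambda>i. c i (r i)) n \<in> W))"
  using assms
proof (induction n arbitrary: \<O>)
  case 0
  then show ?case by auto
next
  case (Suc n)
  have K: "compactin T (set_mult_prod G X n)" using Suc.prems(1) by (intro compactin_set_mult_prod) auto
  have Xn: "compactin T (X n)" "connectedin T (X n)" "a n \<in> X n" "b n \<in> X n" using Suc.prems(1) by auto
  have "\<exists>\<U> \<V>. (\<forall>U\<in>\<U>. openin T U) \<and> X n \<subseteq> \<Union>\<U> \<and> (\<forall>V\<in>\<V>. openin T V) \<and> set_mult_prod G X n \<subseteq> \<Union>\<V> \<and>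
    (\<forall>U\<in>\<U>. \<forall>V\<in>\<V>. \<exists>W\<in>\<O>. \<forall>v\<in>V. \<forall>u\<in>U. v \<otimes> u \<in> W)"
  proof (rule compactin_box_refine[OF K Xn(1) mult_cont])
    show "k \<otimes> z \<in> \<Union>\<O>" if "k \<in> set_mult_prod G X n" "z \<in> X n" for k z
    proof -
      have "(\<lambda>(a, b). a \<otimes> b) (k, z) \<in> set_mult_prod G X (Suc n)"
        unfolding set_mult_prod_Suc using that by (intro imageI) simp
      then show ?thesis using Suc.prems(3) by auto
    qed
  qed (rule Suc.prems(2))
  then obtain \<U> \<V> where UV: "\<forall>U\<in>\<U>. openin T U" "X n \<subseteq> \<Union>\<U>" "\<forall>V\<in>\<V>. openin T V" "set_mult_prod G X n \<subseteq> \<Union>\<V>"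
    "\<forall>U\<in>\<U>. \<forall>V\<in>\<V>. \<exists>W\<in>\<O>. \<forall>v\<in>V. \<forall>u\<in>U. v \<otimes> u \<in> W" by blast
  obtain p1 where p1: "\<forall>p\<ge>p1. \<exists>c::nat \<Rightarrow> nat \<Rightarrow> 'a. (\<forall>i<n. c i 0 = a i \<and> c i p = b i \<and> (\<forall>j\<le>p. c i j \<in> X i)) \<and>
    (\<forall>q. (\<forall>i<n. q i < p) \<longrightarrow>
      (\<exists>W\<in>\<V>. \<forall>r. (\<forall>i<n. q i \<le> r i \<and> r i \<le> Suc (q i)) \<longrightarrow> iter_mult G (\<lambda>i. c i (r i)) n \<in> W))"
    using Suc.IH[of \<V>, OF Suc.prems(1)[OF less_SucI] UV(3)[rule_format] UV(4)] by (rule exE)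
  obtain p2 where p2: "\<forall>p\<ge>p2. \<exists>c::nat \<Rightarrow> 'a. c 0 = a n \<and> c p = b n \<and> (\<forall>j\<le>p. c j \<in> X n) \<and>
           (\<forall>j<p. \<exists>U\<in>\<U>. c j \<in> U \<and> c (Suc j) \<in> U)"
    using connectedin_chain[OF Xn(2) UV(1)[rule_format] UV(2) Xn(3,4)] by (rule exE)
  show ?case
  proof (intro exI[of _ "max p1 p2"] allI impI)
    fix p assume p: "p \<ge> max p1 p2"
    have "p1 \<le> p" "p2 \<le> p" using p by simp_all
    from p1[THEN spec, THEN mp, OF this(1)] obtain c where
      c0: "(\<forall>i<n. c i 0 = a i \<and> c i p = b i \<and> (\<forall>j\<le>p. c i j \<in> X i)) \<and>
      (\<forall>q. (\<forall>i<n. q i < p) \<longrightarrow>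
      (\<exists>W\<in>\<V>. \<forall>r. (\<forall>i<n. q i \<le> r i \<and> r i \<le> Suc (q i)) \<longrightarrow> iter_mult G (\<lambda>i. c i (r i)) n \<in> W))"
      by (rule exE)
    note c = c0[THEN conjunct1] and cq = c0[THEN conjunct2, THEN spec, THEN mp]
    from p2[THEN spec, THEN mp, OF \<open>p2 \<le> p\<close>] obtain d where
      d0: "d 0 = a n \<and> d p = b n \<and> (\<forall>j\<le>p. d j \<in> X n) \<and> (\<forall>j<p. \<exists>U\<in>\<U>. d j \<in> U \<and> d (Suc j) \<in> U)"
      by (rule exE)
    then have d: "d 0 = a n" "d p = b n" "\<forall>j\<le>p. d j \<in> X n"
        "\<And>j. j < p \<Longrightarrow> \<exists>U\<in>\<U>. d j \<in> U \<and> d (Suc j) \<in> U" by auto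
    let ?e = "c(n := d)"
    have eq: "iter_mult G (\<lambda>i. ?e i (r i)) (Suc n) = iter_mult G (\<lambda>i. c i (r i)) n \<otimes> d (r n)" for r
    proof -
      have "iter_mult G (\<lambda>i. ?e i (r i)) n = iter_mult G (\<lambda>i. c i (r i)) n"
        by (rule iter_mult_cong) auto
      then show ?thesis by simp
    qed
    have g: "\<exists>W\<in>\<O>. \<forall>r. (\<forall>i<Suc n. q i \<le> r i \<and> r i \<le> Suc (q i)) \<longrightarrow> iter_mult G (\<lambda>i. ?e i (r i)) (Suc n) \<in> W"
      if q: "\<forall>i<Suc n. q i < p" for q
    proof -
      have "\<forall>i<n. q i < p" using q by simp
      from cq[OF this] obtain V where V: "V\<in>\<V>"
          "\<forall>r. (\<forall>i<n. q i \<le> r i \<and> r i \<le> Suc (q i)) \<longrightarrow> iter_mult G (\<lambda>i. c i (r i)) n \<in> V"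
        by (rule bexE)
      obtain U where U: "U \<in> \<U>" "d (q n) \<in> U" "d (Suc (q n)) \<in> U" using d(4)[of "q n"] q by auto
      obtain W where W: "W \<in> \<O>" "\<forall>v\<in>V. \<forall>u\<in>U. v \<otimes> u \<in> W" using UV(5) U V by blast
      have "iter_mult G (\<lambda>i. ?e i (r i)) (Suc n) \<in> W" if r: "\<forall>i<Suc n. q i \<le> r i \<and> r i \<le> Suc (q i)" for r
      proof -
        have "r n = q n \<or> r n = Suc (q n)" using r by (metis le_SucE le_antisym lessI)
        then have "d (r n) \<in> U" using U by auto
        moreover have "iter_mult G (\<lambda>i. c i (r i)) n \<in> V"
          using V(2)[THEN spec, THEN mp, of r] r by simp
        ultimately show ?thesis unfolding eq using W by blast
      qed
      then show ?thesis by (intro bexI[OF _ W(1)] allI impI)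
    qed
    have ends: "\<forall>i<Suc n. ?e i 0 = a i \<and> ?e i p = b i \<and> (\<forall>j\<le>p. ?e i j \<in> X i)"
    proof (intro allI impI)
      fix i assume "i < Suc n"
      then consider "i = n" | "i < n" "i \<noteq> n" by linarith
      then show "?e i 0 = a i \<and> ?e i p = b i \<and> (\<forall>j\<le>p. ?e i j \<in> X i)"
        by cases (use c d in simp_all)
    qed
    show "\<exists>c. (\<forall>i<Suc n. c i 0 = a i \<and> c i p = b i \<and> (\<forall>j\<le>p. c i j \<in> X i)) \<and>
    (\<forall>q. (\<forall>i<Suc n. q i < p) \<longrightarrow>
      (\<exists>W\<in>\<O>. \<forall>r. (\<forall>i<Suc n. q i \<le> r i \<and> r i \<le> Suc (q i)) \<longrightarrow> iter_mult G (\<lambda>i. c i (r i)) (Suc n) \<in> W))"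
      by (rule exI[of _ ?e], rule conjI, rule ends, intro allI impI, rule g)
  qed
qed

end

section \<open>A Lebesgue covering argument for products of continua\<close>

lemma set_mult_prod_mono:
  "(\<And>i. i < n \<Longrightarrow> X i \<subseteq> Y i) \<Longrightarrow> set_mult_prod G X n \<subseteq> set_mult_prod G Y n"
  unfolding set_mult_prod_def by (intro image_mono) blast

context top_group begin

text \<open>Each grid point picks a member of the cover containing its image, and its i-th label
  records whether that member misses the face x_i = b_i. Kuhn's lemma yields a simplex carrying all
  \<open>n + 1\<close> reduced labels; as it lies in one small cube, all members picked on it share
  a point \<open>k\<close>.\<close>

lemma grid_cover_multiplicity:
  fixes F :: "'i \<Rightarrow> 'a set"
  assumes X: "\<And>i. i < n \<Longrightarrow> compactin T (X i) \<and> connectedin T (X i) \<and> a i \<in> X i \<and> b i \<in> X i"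
    and I: "finite I" "\<And>j. j \<in> I \<Longrightarrow> closedin T (F j)"
    and cov: "set_mult_prod G X n \<subseteq> (\<Union>j\<in>I. F j)"
    and sep: "\<And>i j. i < n \<Longrightarrow> j \<in> I \<Longrightarrow>
      F j \<inter> set_mult_prod G (X(i := {a i})) n = {} \<or> F j \<inter> set_mult_prod G (X(i := {b i})) n = {}"
  shows "\<exists>p. n < card {j\<in>I. p \<in> F j}"
proof -
  let ?K = "set_mult_prod G X n"
  have KT: "?K \<subseteq> topspace T"
    using X by (intro compactin_subset_topspace compactin_set_mult_prod) auto
  \<comment> \<open>Removing the finitely many members that avoid \<open>k\<close> leaves an open
    set in which every member it meets contains \<open>k\<close>; this turns a common small set into
    a common point.\<close>
  define U where "U k = topspace T - \<Union>(F ` {j\<in>I. k \<notin> F j})" for k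
  have opU: "openin T (U k)" for k
    unfolding U_def using I by (intro openin_diff closedin_Union) auto
  have UF: "k \<in> F j" if "j \<in> I" "z \<in> F j" "z \<in> U k" for j z k
    using that by (auto simp: U_def)
  have opens: "\<And>W. W \<in> U ` ?K \<Longrightarrow> openin T W" using opU by auto
  have "?K \<subseteq> \<Union>(U ` ?K)" using KT by (auto simp: U_def)
  from iter_mult_grid[of n X a b "U ` ?K", OF X opens this] obtain p0 where p0: "\<forall>p\<ge>p0. \<exists>c::nat \<Rightarrow> nat \<Rightarrow> 'a.
     (\<forall>i<n. c i 0 = a i \<and> c i p = b i \<and> (\<forall>j\<le>p. c i j \<in> X i)) \<and>
    (\<forall>q. (\<forall>i<n. q i < p) \<longrightarrow>
      (\<exists>W\<in>U ` ?K. \<forall>r. (\<forall>i<n. q i \<le> r i \<and> r i \<le> Suc (q i)) \<longrightarrow> iter_mult G (\<lambda>i. c i (r i)) n \<in> W))"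
    by (rule exE)
  \<comment> \<open>Kuhn's lemma needs a positive number of subdivisions.\<close>
  define p where "p = Suc p0"
  have "p0 \<le> p" "0 < p" by (auto simp: p_def)
  from p0[THEN spec, THEN mp, OF this(1)] obtain c where
    c0: "(\<forall>i<n. c i 0 = a i \<and> c i p = b i \<and> (\<forall>j\<le>p. c i j \<in> X i)) \<and>
    (\<forall>q. (\<forall>i<n. q i < p) \<longrightarrow>
      (\<exists>W\<in>U ` ?K. \<forall>r. (\<forall>i<n. q i \<le> r i \<and> r i \<le> Suc (q i)) \<longrightarrow> iter_mult G (\<lambda>i. c i (r i)) n \<in> W))"
    by (rule exE)
  note c = c0[THEN conjunct1, rule_format] and cq = c0[THEN conjunct2, THEN spec, THEN mp]
  define pt where "pt r = iter_mult G (\<lambda>i. c i (r i)) n" for r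
  define V where "V r = (SOME j. j \<in> I \<and> pt r \<in> F j)" for r
  define A where "A i = set_mult_prod G (X(i := {a i})) n" for i
  define B where "B i = set_mult_prod G (X(i := {b i})) n" for i
  have V: "V r \<in> I \<and> pt r \<in> F (V r)" if "\<forall>i<n. r i \<le> p" for r
  proof -
    have "pt r \<in> ?K" unfolding pt_def using c that by (intro iter_mult_in_prod) auto
    then have "\<exists>j. j \<in> I \<and> pt r \<in> F j" using cov by auto
    then show ?thesis unfolding V_def by (rule someI_ex)
  qed
  have ptA: "pt r \<in> A i" if "\<forall>i<n. r i \<le> p" "i < n" "r i = 0" for r i
    unfolding pt_def A_def by (rule iter_mult_in_prod) (use c that in auto)
  have ptB: "pt r \<in> B i" if "\<forall>i<n. r i \<le> p" "i < n" "r i = p" for r i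
    unfolding pt_def B_def by (rule iter_mult_in_prod) (use c that in auto)
  \<comment> \<open>On x_i = 0 the chosen member meets \<open>A i\<close>, so by \<open>sep\<close>
    it misses \<open>B i\<close> and gets 0; on x_i = p it meets \<open>B i\<close> and gets 1.
    These are the boundary conditions of Kuhn's lemma.\<close>
  define lab where "lab r i = (if F (V r) \<inter> B i = {} then 0 else 1::nat)" for r i
  have "odd (card {s. ksimplex p n s \<and> (reduced n\<circ>lab) ` s = {..n}})"
  proof (rule kuhn_combinatorial[OF \<open>0 < p\<close>]; intro allI impI; elim conjE)
    fix x :: "nat \<Rightarrow> nat" and j assume *: "\<forall>j. x j \<le> p" "j < n" "x j = 0"
    then have "F (V x) \<inter> A j \<noteq> {}" "V x \<in> I" using V[of x] ptA[of x j] by auto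
    then have "F (V x) \<inter> B j = {}" using sep[OF *(2)] unfolding A_def B_def by blast
    then show "lab x j = 0" by (simp add: lab_def)
  next
    fix x :: "nat \<Rightarrow> nat" and j assume *: "\<forall>j. x j \<le> p" "j < n" "x j = p"
    then have "F (V x) \<inter> B j \<noteq> {}" using V[of x] ptB[of x j] by auto
    then show "lab x j = 1" by (simp add: lab_def)
  qed
  then have "{s. ksimplex p n s \<and> (reduced n\<circ>lab) ` s = {..n}} \<noteq> {}"
    by (rule odd_card_imp_not_empty)
  then obtain s base upd where "kuhn_simplex p n base upd s" and rl: "(reduced n\<circ>lab) ` s = {..n}"
    by (auto elim: ksimplex.cases)
  interpret kuhn_simplex p n base upd s by fact
  \<comment> \<open>The vertices of a Kuhn simplex exceed \<open>base\<close> by 0 or 1 in each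
    coordinate, so the whole simplex lies in the cube with lower corner \<open>base\<close>.\<close>
  have "\<forall>i<n. base i < p" using base by auto
  from cq[OF this] obtain W where "W \<in> U ` ?K"
    and W: "\<forall>r. (\<forall>i<n. base i \<le> r i \<and> r i \<le> Suc (base i)) \<longrightarrow> pt r \<in> W"
    unfolding pt_def by (rule bexE)
  then obtain k where k: "W = U k" by auto
  have "k \<in> F (V r) \<and> V r \<in> I" if r: "r \<in> s" for r
  proof -
    have "\<forall>i<n. base i \<le> r i \<and> r i \<le> Suc (base i)" using r by (auto simp: s_eq enum_def)
    then have "pt r \<in> U k" using W k by auto
    moreover have "\<forall>i<n. r i \<le> p" using s_le_p[OF r] by auto
    then have "V r \<in> I" "pt r \<in> F (V r)" using V by auto
    ultimately show ?thesis using UF by blast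
  qed
  then have sub: "V ` s \<subseteq> {j\<in>I. k \<in> F j}" by auto
  \<comment> \<open>The reduced label of a vertex depends only on the member of the cover chosen for it, so \<open>n + 1\<close> labels
    need \<open>n + 1\<close> different members.\<close>
  define g where "g j = reduced n (\<lambda>i. if F j \<inter> B i = {} then 0 else 1)" for j
  have "(reduced n\<circ>lab) r = g (V r)" for r by (simp add: g_def lab_def[abs_def])
  then have "{..n} = g ` (V ` s)" using rl by (metis (no_types, lifting) image_cong image_image)
  then have "Suc n \<le> card (g ` (V ` s))" by (metis card_atMost order_refl)
  moreover have fin: "finite {j\<in>I. k \<in> F j}" using I by auto
  ultimately have "Suc n \<le> card (V ` s)"
    using card_image_le[of "V ` s" g] finite_subset[OF sub fin] by linarith
  also have "\<dots> \<le> card {j\<in>I. k \<in> F j}" by (rule card_mono[OF fin sub])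
  finally show ?thesis by (intro exI[of _ k]) simp
qed

text \<open>Open sets that avoid one face of every opposite pair cover the product. A refinement of
  order at most \<open>N\<close>, shrunk to closed sets, meets the hypotheses of
  \<open>grid_cover_multiplicity\<close>, which gives a point in more than \<open>n\<close> of its
  members.\<close>

lemma separated_faces_dim:
  assumes X: "\<And>i. i < n \<Longrightarrow> compactin T (X i) \<and> connectedin T (X i) \<and> a i \<in> X i \<and> b i \<in> X i"
    and disj: "\<And>i. i < n \<Longrightarrow> set_mult_prod G (X(i := {a i})) n \<inter> set_mult_prod G (X(i := {b i})) n = {}"
    and dim: "covering_dim_le (subtopology T (set_mult_prod G X n)) N"
  shows "n \<le> N"
proof (rule ccontr)
  assume "\<not> n \<le> N"
  define K where "K = set_mult_prod G X n"
  define A where "A i = set_mult_prod G (X(i := {a i})) n" for i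
  define B where "B i = set_mult_prod G (X(i := {b i})) n" for i
  let ?S = "subtopology T K"
  have K: "compactin T K" unfolding K_def using X by (intro compactin_set_mult_prod) auto
  then have KT: "K \<subseteq> topspace T" by (rule compactin_subset_topspace)
  then have tS: "topspace ?S = K" by auto
  have pts: "compactin T {a i}" "compactin T {b i}" if "i < n" for i
    using X[OF that] compactin_subset_topspace[of T "X i"] by auto
  have "compactin T (A i)" "compactin T (B i)" if "i < n" for i
    unfolding A_def B_def using X pts[OF that] by (auto intro!: compactin_set_mult_prod)
  then have cl: "closedin T (A i)" "closedin T (B i)" if "i < n" for i
    using Hausdorff compactin_imp_closedin that by blast+
  have sub: "A i \<subseteq> K" "B i \<subseteq> K" if "i < n" for i
    unfolding A_def B_def K_def using X[OF that] by (auto intro!: set_mult_prod_mono split: if_splits)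
  have clo: "closedin ?S (A i)" "closedin ?S (B i)" if "i < n" for i
    using closedin_subset_topspace[OF cl(1)[OF that] sub(1)[OF that]]
      closedin_subset_topspace[OF cl(2)[OF that] sub(2)[OF that]] by auto
  \<comment> \<open>\<open>\<sigma>\<close> lists the pairs whose \<open>A\<close> face is avoided;
    in the other pairs the \<open>B\<close> face is. A point \<open>x\<close> of the product lies in
    \<open>D\<close> of the set of all \<open>i\<close> with \<open>x \<in> B i\<close>, since
    opposite faces are disjoint.\<close>
  define D where "D \<sigma> = K - (\<Union>i\<in>\<sigma>. A i) - (\<Union>i\<in>{..<n} - \<sigma>. B i)" for \<sigma>
  have "openin ?S (D \<sigma>)" if "\<sigma> \<subseteq> {..<n}" for \<sigma>
  proof -
    have "finite \<sigma>" using that finite_subset by blast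
    then show ?thesis unfolding D_def using that clo tS openin_topspace[of ?S]
      by (intro openin_diff closedin_Union) auto
  qed
  moreover have "x \<in> \<Union>(D ` Pow {..<n})" if "x \<in> K" for x
  proof -
    have "x \<in> D {i\<in>{..<n}. x \<in> B i}"
      using that disj unfolding D_def A_def B_def by blast
    then show ?thesis by (intro UN_I[of "{i\<in>{..<n}. x \<in> B i}"]) auto
  qed
  moreover have "D \<sigma> \<subseteq> K" for \<sigma> by (auto simp: D_def)
  ultimately have "finite_open_cover ?S (D ` Pow {..<n})"
    unfolding finite_open_cover_def tS by blast
  from dim[folded K_def, unfolded covering_dim_le_def, THEN spec, THEN mp, OF this]
  obtain \<V> where V: "finite_open_cover ?S \<V>" "\<forall>V\<in>\<V>. \<exists>U\<in>D ` Pow {..<n}. V \<subseteq> U"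
      "\<forall>x\<in>topspace ?S. card {V\<in>\<V>. x \<in> V} \<le> N + 1"
    by (elim exE conjE)
  have Vop: "finite \<V>" "\<forall>V\<in>\<V>. openin ?S V" "\<Union>\<V> = K"
    using V(1) unfolding finite_open_cover_def tS by auto
  have "compact_space ?S" "Hausdorff_space ?S"
    using K Hausdorff by (auto simp: compact_space_subtopology Hausdorff_space_subtopology)
  then have "normal_space ?S"
    using compact_Hausdorff_or_regular_imp_normal_space by blast
  from finite_cover_shrink[OF this Vop(1,2), of K]
  obtain F where F: "\<forall>V\<in>\<V>. closedin ?S (F V) \<and> F V \<subseteq> V" "K \<subseteq> (\<Union>V\<in>\<V>. F V)"
    using Vop(3) closedin_topspace[of ?S] unfolding tS by auto
  have "\<exists>p. n < card {j\<in>\<V>. p \<in> F j}"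
  proof (rule grid_cover_multiplicity[OF X Vop(1)])
    show "closedin T (F V)" if "V \<in> \<V>" for V
      using F(1) that K Hausdorff compactin_imp_closedin closedin_trans_full by blast
    show "set_mult_prod G X n \<subseteq> (\<Union>V\<in>\<V>. F V)" using F(2) by (simp add: K_def)
    show "F V \<inter> set_mult_prod G (X(i := {a i})) n = {} \<or> F V \<inter> set_mult_prod G (X(i := {b i})) n = {}"
      if iV: "i < n" "V \<in> \<V>" for i V
    proof -
      obtain \<sigma> where "V \<subseteq> D \<sigma>" using V(2) iV by auto
      then have "F V \<subseteq> D \<sigma>" using F(1) iV by blast
      then show ?thesis using iV unfolding D_def A_def B_def by (cases "i \<in> \<sigma>") auto
    qed
  qed
  then obtain p where p: "n < card {j\<in>\<V>. p \<in> F j}" by blast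
  then have "{j\<in>\<V>. p \<in> F j} \<noteq> {}" by (metis card.empty not_less_zero)
  then have "p \<in> topspace ?S" using F(1) Vop(3) unfolding tS by blast
  moreover have "card {j\<in>\<V>. p \<in> F j} \<le> card {V\<in>\<V>. p \<in> V}"
    using F(1) Vop(1) by (intro card_mono) auto
  ultimately have "n < N + 1" using V(3) p by (meson le_less_trans less_le_trans order_less_le_trans)
  then show False using \<open>\<not> n \<le> N\<close> by simp
qed

section \<open>Independent small continua through the unit\<close>

lemma nhd_one_mult:
  assumes "openin T W" "\<one> \<in> W"
  shows "\<exists>V. openin T V \<and> \<one> \<in> V \<and> (\<forall>x\<in>V. \<forall>y\<in>V. x \<otimes> y \<in> W \<and> x \<otimes> inv y \<in> W)"
proof -
  have aux: "\<exists>V. openin T V \<and> \<one> \<in> V \<and> (\<forall>x\<in>V. \<forall>y\<in>V. h x y \<in> W)"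
    if h: "continuous_map (prod_topology T T) T (\<lambda>(x, y). h x y)" and 1: "h \<one> \<one> \<in> W" for h
  proof -
    define P where "P = {p \<in> topspace (prod_topology T T). (\<lambda>(x, y). h x y) p \<in> W}"
    have "openin (prod_topology T T) P"
      unfolding P_def by (rule openin_continuous_map_preimage[OF h assms(1)])
    moreover have "(\<one>, \<one>) \<in> P" using 1 by (auto simp: P_def topspace_eq)
    ultimately obtain V U where VU: "openin T V" "openin T U" "\<one> \<in> V" "\<one> \<in> U" "V \<times> U \<subseteq> P"
      by (metis openin_prod_topology_alt)
    then have "\<forall>v\<in>V \<inter> U. \<forall>u\<in>V \<inter> U. h v u \<in> W" by (auto simp: P_def)
    then show ?thesis using VU by (intro exI[of _ "V \<inter> U"]) auto
  qed
  obtain V1 where V1: "openin T V1" "\<one> \<in> V1" "\<forall>x\<in>V1. \<forall>y\<in>V1. x \<otimes> y \<in> W"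
    using aux[OF mult_cont] assms by auto
  have "continuous_map (prod_topology T T) T (\<lambda>z. inv (snd z))"
    using continuous_map_compose[OF continuous_map_snd inv_cont] by (simp add: o_def)
  then have "continuous_map (prod_topology T T) (prod_topology T T) (\<lambda>z. (fst z, inv (snd z)))"
    by (simp add: continuous_map_pairedI continuous_map_fst)
  then have "continuous_map (prod_topology T T) T (\<lambda>(x, y). x \<otimes> inv y)"
    using continuous_map_compose[OF _ mult_cont] by (force simp: o_def case_prod_unfold)
  then obtain V2 where V2: "openin T V2" "\<one> \<in> V2" "\<forall>x\<in>V2. \<forall>y\<in>V2. x \<otimes> inv y \<in> W"
    using aux[of "\<lambda>x y. x \<otimes> inv y"] assms by auto
  show ?thesis using V1 V2 by (intro exI[of _ "V1 \<inter> V2"]) auto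
qed

lemma continuous_left_mult:
  assumes "g \<in> carrier G"
  shows "continuous_map T T (\<lambda>z. g \<otimes> z)"
proof -
  have "continuous_map T (prod_topology T T) (\<lambda>z. (g, z))"
    using assms topspace_eq by (simp add: continuous_map_pairedI)
  then show ?thesis using continuous_map_compose[OF _ mult_cont] by (force simp: o_def)
qed

lemma continuous_right_mult:
  assumes "g \<in> carrier G"
  shows "continuous_map T T (\<lambda>z. z \<otimes> g)"
proof -
  have "continuous_map T (prod_topology T T) (\<lambda>z. (z, g))"
    using assms topspace_eq by (simp add: continuous_map_pairedI)
  then show ?thesis using continuous_map_compose[OF _ mult_cont] by (force simp: o_def)
qed

text \<open>The neighbourhood \<open>W\<close> is slack kept for the induction: the images stay
  apart after right multiplication by its elements, and the next continuum is so small that its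
  points, times the new slack, remain in \<open>W\<close>. Separation in the new coordinate comes
  from \<open>\<beta>\<close> lying outside \<open>C\<close>.\<close>

lemma independent_continua:
  assumes escape: "\<forall>C U. compactin T C \<and> openin T U \<and> \<one> \<in> U \<longrightarrow>
    (\<exists>b Z. b \<in> Z \<and> \<one> \<in> Z \<and> b \<notin> C \<and> Z \<subseteq> U \<and> compactin T Z \<and> connectedin T Z)"
  shows "\<exists>X b W. (\<forall>i<n. compactin T (X i) \<and> connectedin T (X i) \<and> \<one> \<in> X i \<and> b i \<in> X i) \<and>
    openin T W \<and> \<one> \<in> W \<and>
    (\<forall>i x y u v. i < n \<and> (\<forall>j<n. x j \<in> X j \<and> y j \<in> X j) \<and> x i = \<one> \<and> y i = b i \<and> u \<in> W \<and> v \<in> W \<longrightarrow>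
      iter_mult G x n \<otimes> u \<noteq> iter_mult G y n \<otimes> v)"
proof (induction n)
  case 0
  show ?case using topspace_eq openin_topspace[of T] by auto
next
  case (Suc n)
  then obtain X b W where X: "\<forall>i<n. compactin T (X i) \<and> connectedin T (X i) \<and> \<one> \<in> X i \<and> b i \<in> X i"
    and W: "openin T W" "\<one> \<in> W"
    and sep: "\<forall>i x y u v. i < n \<and> (\<forall>j<n. x j \<in> X j \<and> y j \<in> X j) \<and> x i = \<one> \<and> y i = b i \<and> u \<in> W \<and> v \<in> W \<longrightarrow>
      iter_mult G x n \<otimes> u \<noteq> iter_mult G y n \<otimes> v"
    by (elim exE conjE)
  define K where "K = set_mult_prod G X n"
  have K: "compactin T K" unfolding K_def using X by (intro compactin_set_mult_prod) auto
  \<comment> \<open>This is K^-1 K: an equation x = y \<beta> with x and y in \<open>K\<close> would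
    put \<open>\<beta>\<close> into it.\<close>
  define C where "C = (\<lambda>(a, b). a \<otimes> b) ` ((\<lambda>x. inv x) ` K \<times> K)"
  have C: "compactin T C"
    unfolding C_def by (intro compactin_mult K image_compactin[OF K inv_cont])
  obtain V where V: "openin T V" "\<one> \<in> V" "\<forall>x\<in>V. \<forall>y\<in>V. x \<otimes> y \<in> W \<and> x \<otimes> inv y \<in> W"
    using nhd_one_mult[OF W] by (elim exE conjE)
  obtain \<beta> Z where Z: "\<beta> \<in> Z" "\<one> \<in> Z" "\<beta> \<notin> C" "Z \<subseteq> V" "compactin T Z" "connectedin T Z"
    using escape[rule_format, OF conjI[OF C conjI[OF V(1,2)]]] by (elim exE conjE)
  have sub: "C \<subseteq> carrier G" "Z \<subseteq> carrier G" "V \<subseteq> carrier G" "W \<subseteq> carrier G" "K \<subseteq> carrier G"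
    using C Z V W K compactin_subset_topspace openin_subset topspace_eq by metis+
  have \<beta>: "\<beta> \<in> carrier G" using Z sub by auto
  \<comment> \<open>This is the set of all \<open>inv c \<otimes> \<beta>\<close> with
    \<open>c\<close> in \<open>C\<close>. It is compact and misses the unit, so some neighbourhood
    \<open>U\<close> of the unit has all quotients \<open>u \<otimes> inv v\<close> outside
    \<open>E\<close>; a coincidence in the new coordinate would force such a quotient into
    \<open>E\<close>.\<close>
  define E where "E = (\<lambda>z. z \<otimes> \<beta>) ` (\<lambda>x. inv x) ` C"
  have "compactin T E"
    unfolding E_def by (intro image_compactin[OF _ continuous_right_mult[OF \<beta>]] image_compactin[OF C inv_cont])
  then have "openin T (topspace T - E)"
    using compactin_imp_closedin[OF Hausdorff] by blast
  moreover have "\<one> \<notin> E"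
  proof
    assume "\<one> \<in> E"
    then obtain c where c: "c \<in> C" "inv c \<otimes> \<beta> = \<one>" by (auto simp: E_def)
    then have cG: "c \<in> carrier G" using sub by auto
    then have "c \<otimes> (inv c \<otimes> \<beta>) = c" using c by simp
    then have "\<beta> = c" using cG \<beta> by (simp add: m_assoc[symmetric])
    then show False using c Z by simp
  qed
  ultimately obtain U where U: "openin T U" "\<one> \<in> U"
      "\<forall>x\<in>U. \<forall>y\<in>U. x \<otimes> y \<in> topspace T - E \<and> x \<otimes> inv y \<in> topspace T - E"
    using nhd_one_mult[of "topspace T - E"] by (auto simp: topspace_eq)
  define X' where "X' = X(n := Z)"
  define b' where "b' = b(n := \<beta>)"
  have X': "\<forall>i<Suc n. compactin T (X' i) \<and> connectedin T (X' i) \<and> \<one> \<in> X' i \<and> b' i \<in> X' i"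
    using X Z by (auto simp: X'_def b'_def less_Suc_eq)
  have "iter_mult G x (Suc n) \<otimes> u \<noteq> iter_mult G y (Suc n) \<otimes> v"
    if *: "i < Suc n" "\<forall>j<Suc n. x j \<in> X' j \<and> y j \<in> X' j" "x i = \<one>" "y i = b' i" "u \<in> U \<inter> V" "v \<in> U \<inter> V"
    for i x y u v
  proof
    assume eq: "iter_mult G x (Suc n) \<otimes> u = iter_mult G y (Suc n) \<otimes> v"
    have xy: "\<forall>j<n. x j \<in> X j \<and> y j \<in> X j" "x n \<in> Z" "y n \<in> Z"
      using *(2) by (auto simp: X'_def less_Suc_eq)
    let ?gx = "iter_mult G x n" and ?gy = "iter_mult G y n"
    have gK: "?gx \<in> K" "?gy \<in> K" unfolding K_def using xy by (auto intro!: iter_mult_in_prod)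
    have car: "?gx \<in> carrier G" "?gy \<in> carrier G" "x n \<in> carrier G" "y n \<in> carrier G"
      "u \<in> carrier G" "v \<in> carrier G" using gK xy sub * by auto
    have eq': "?gx \<otimes> (x n \<otimes> u) = ?gy \<otimes> (y n \<otimes> v)" using eq car by (simp add: m_assoc)
    show False
    proof (cases "i = n")
      \<comment> \<open>For an earlier coordinate the new factors join the slack:
        \<open>x n \<otimes> u\<close> and \<open>y n \<otimes> v\<close> lie in \<open>W\<close>,
        and the induction hypothesis applies.\<close>
      case False
      then have "i < n" "y i = b i" using * by (auto simp: b'_def)
      moreover have "x n \<otimes> u \<in> W" "y n \<otimes> v \<in> W" using V(3) Z(4) xy * by auto
      ultimately show False using sep xy(1) *(3) eq' by blast
    next
      case True
      then have "x n = \<one>" "y n = \<beta>" using * by (auto simp: b'_def)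
      then have e: "?gx \<otimes> u = ?gy \<otimes> (\<beta> \<otimes> v)" using eq' car by simp
      define c where "c = inv ?gy \<otimes> ?gx"
      have cC: "c \<in> C" unfolding c_def C_def using gK by force
      then have cG: "c \<in> carrier G" using sub by auto
      have "c \<otimes> u = inv ?gy \<otimes> (?gx \<otimes> u)" unfolding c_def using car by (simp add: m_assoc)
      also have "\<dots> = \<beta> \<otimes> v" unfolding e using car \<beta> by (simp add: m_assoc[symmetric])
      finally have cu: "c \<otimes> u = \<beta> \<otimes> v" .
      have "u \<otimes> inv v = inv c \<otimes> (c \<otimes> u) \<otimes> inv v" using cG car by (simp add: m_assoc[symmetric])
      also have "\<dots> = inv c \<otimes> \<beta>" unfolding cu using cG car \<beta> by (simp add: m_assoc)
      finally have "u \<otimes> inv v = inv c \<otimes> \<beta>" .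
      moreover have "inv c \<otimes> \<beta> \<in> E" unfolding E_def using cC by auto
      moreover have "u \<otimes> inv v \<notin> E" using U(3) * by blast
      ultimately show False by simp
    qed
  qed
  then show ?case
    using X' U(1,2) V(1,2)
    by (intro exI[of _ X'] exI[of _ b'] exI[of _ "U \<inter> V"] conjI allI impI openin_Int IntI) auto
qed

text \<open>One continuum more than the proposed bound \<open>N\<close> suffices:
  \<open>separated_faces_dim\<close> would give \<open>Suc N \<le> N\<close>.\<close>

lemma escape_imp_not_compactly_finite_dim:
  assumes escape: "\<forall>C U. compactin T C \<and> openin T U \<and> \<one> \<in> U \<longrightarrow>
    (\<exists>b Z. b \<in> Z \<and> \<one> \<in> Z \<and> b \<notin> C \<and> Z \<subseteq> U \<and> compactin T Z \<and> connectedin T Z)"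
  shows "\<exists>K. compactin T K \<and> \<not> covering_dim_le (subtopology T K) N"
proof -
  define n where "n = Suc N"
  from independent_continua[OF escape, of n]
  obtain X b W where X: "\<forall>i<n. compactin T (X i) \<and> connectedin T (X i) \<and> \<one> \<in> X i \<and> b i \<in> X i"
    and W: "openin T W" "\<one> \<in> W"
    and sep: "\<forall>i x y u v. i < n \<and> (\<forall>j<n. x j \<in> X j \<and> y j \<in> X j) \<and> x i = \<one> \<and> y i = b i \<and> u \<in> W \<and> v \<in> W \<longrightarrow>
      iter_mult G x n \<otimes> u \<noteq> iter_mult G y n \<otimes> v"
    by (elim exE conjE)
  have XG: "X i \<subseteq> carrier G" if "i < n" for i
    using X that compactin_subset_topspace topspace_eq by metis
  have "set_mult_prod G (X(i := {\<one>})) n \<inter> set_mult_prod G (X(i := {b i})) n = {}" if i: "i < n" for i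
  proof (rule equals0I)
    fix p assume "p \<in> set_mult_prod G (X(i := {\<one>})) n \<inter> set_mult_prod G (X(i := {b i})) n"
    then obtain x y where x: "\<forall>j<n. x j \<in> (X(i := {\<one>})) j" "p = iter_mult G x n"
      and y: "\<forall>j<n. y j \<in> (X(i := {b i})) j" "p = iter_mult G y n"
      unfolding set_mult_prod_def by blast
    have "x i = \<one>" "y i = b i" using x(1) y(1) i by force+
    moreover have "\<forall>j<n. x j \<in> X j \<and> y j \<in> X j"
    proof (intro allI impI)
      fix j assume j: "j < n"
      show "x j \<in> X j \<and> y j \<in> X j"
      proof (cases "j = i")
        case True
        then show ?thesis using \<open>x i = \<one>\<close> \<open>y i = b i\<close> X i by simp
      next
        case False
        then show ?thesis using x(1)[rule_format, OF j] y(1)[rule_format, OF j] by simp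
      qed
    qed
    \<comment> \<open>Both slack elements are taken to be the unit.\<close>
    ultimately have "iter_mult G x n \<otimes> \<one> \<noteq> iter_mult G y n \<otimes> \<one>"
      using sep i W(2) by blast
    then show False using x(2) y(2) by simp
  qed
  then have "\<not> covering_dim_le (subtopology T (set_mult_prod G X n)) N"
    using separated_faces_dim[of n X "\<lambda>_. \<one>" b N] X n_def by auto
  moreover have "compactin T (set_mult_prod G X n)"
    using X by (intro compactin_set_mult_prod) auto
  ultimately show ?thesis by blast
qed

end

section \<open>Local compactness of closed subspaces\<close>

lemma covering_dim_le_mono: "covering_dim_le X m \<Longrightarrow> m \<le> n \<Longrightarrow> covering_dim_le X n"
  unfolding covering_dim_le_def by (meson add_le_mono1 order_trans)

text \<open>A finite infimum in \<open>enat\<close> is attained: the infimum of the empty set is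
  \<open>\<infinity>\<close>, and a nonempty set has a least element.\<close>

lemma covering_dim_leD:
  assumes "covering_dim X \<le> enat N"
  shows "covering_dim_le X N"
proof -
  let ?S = "{enat n |n. covering_dim_le X n}"
  have "?S \<noteq> {}" using assms unfolding covering_dim_def Inf_enat_def by (auto split: if_splits)
  then have "Inf ?S \<in> ?S" unfolding Inf_enat_def by (auto intro: LeastI)
  then obtain n where "covering_dim X = enat n" "covering_dim_le X n"
    unfolding covering_dim_def by blast
  then show ?thesis using assms covering_dim_le_mono by auto
qed

lemma covering_dim_leI: "covering_dim_le X N \<Longrightarrow> covering_dim X \<le> enat N"
  unfolding covering_dim_def by (intro Inf_lower) auto

lemma top_groupI: "topological_group G T \<Longrightarrow> top_group G T"
  unfolding topological_group_def top_group_def top_group_axioms_def by auto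

text \<open>If every neighbourhood of \<open>x0\<close> leaves every compact set, local
  continuum-connectedness joins \<open>x0\<close>, inside a prescribed neighbourhood, to a point
  outside a prescribed compact set. Translating \<open>x0\<close> to the unit gives the escape
  property, which rules out a common dimension bound for the compact sets.\<close>

lemma closed_embedding_imp_locally_compact:
  assumes G: "topological_group G T" and dim: "compactly_finite_dimensional T"
    and e: "closed_embedding X T e" and X: "locally_continuum_connected X"
  shows "locally_compact_space X"
proof (rule ccontr)
  assume "\<not> locally_compact_space X"
  then obtain x0 where x0: "x0 \<in> topspace X"
    and nc: "\<And>U K. openin X U \<Longrightarrow> compactin X K \<Longrightarrow> x0 \<in> U \<Longrightarrow> \<not> U \<subseteq> K"
    unfolding locally_compact_space_def by blast
  interpret top_group G T by (rule top_groupI[OF G])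
  have emb: "embedding_map X T e" and clo: "closedin T (e ` topspace X)"
    using e by (auto simp: closed_embedding_def)
  have cont: "continuous_map X T e"
    using emb embedding_map_def homeomorphic_imp_continuous_map continuous_map_in_subtopology by blast
  have "closed_map X T e" "inj_on e (topspace X)"
    using closed_map_from_composition_right emb clo
    by (auto simp: embedding_imp_closed_map_eq embedding_map_def homeomorphic_imp_injective_map)
  \<comment> \<open>Properness makes the preimage of a compact subset of the group compact in
    \<open>X\<close>, so it cannot contain a neighbourhood of \<open>x0\<close>.\<close>
  then have prp: "proper_map X T e" by (rule closed_injective_imp_proper_map)
  have eG: "e x \<in> carrier G" if "x \<in> topspace X" for x
    using cont that topspace_eq by (auto simp: continuous_map_def)
  define g where "g = e x0"
  have g: "g \<in> carrier G" "inv\<^bsub>G\<^esub> g \<in> carrier G" using eG x0 by (auto simp: g_def)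
  have escape: "\<exists>b Z. b \<in> Z \<and> \<one>\<^bsub>G\<^esub> \<in> Z \<and> b \<notin> C \<and> Z \<subseteq> U \<and> compactin T Z \<and> connectedin T Z"
    if C: "compactin T C" and U: "openin T U" "\<one>\<^bsub>G\<^esub> \<in> U" for C U
  proof -
    let ?h = "\<lambda>x. inv\<^bsub>G\<^esub> g \<otimes>\<^bsub>G\<^esub> e x"
    have h: "continuous_map X T ?h"
      using continuous_map_compose[OF cont continuous_left_mult[OF g(2)]] by (simp add: o_def)
    have "compactin T ((\<lambda>z. g \<otimes>\<^bsub>G\<^esub> z) ` C)"
      by (rule image_compactin[OF C continuous_left_mult[OF g(1)]])
    then have Q: "compactin X {x \<in> topspace X. e x \<in> (\<lambda>z. g \<otimes>\<^bsub>G\<^esub> z) ` C}"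
      by (rule compactin_proper_map_preimage[OF prp])
    have "openin X {x \<in> topspace X. ?h x \<in> U}"
      by (rule openin_continuous_map_preimage[OF h U(1)])
    moreover have h0: "?h x0 = \<one>\<^bsub>G\<^esub>" using g by (simp add: g_def[symmetric])
    ultimately obtain V where V: "openin X V" "x0 \<in> V"
      "\<forall>y\<in>V. \<exists>K. subcontinuum X K \<and> x0 \<in> K \<and> y \<in> K \<and> K \<subseteq> {x \<in> topspace X. ?h x \<in> U}"
      using X x0 U(2) unfolding locally_continuum_connected_def locally_continuum_connected_at_def
      by (smt (verit, best) mem_Collect_eq)
    obtain y where y: "y \<in> V" "y \<notin> {x \<in> topspace X. e x \<in> (\<lambda>z. g \<otimes>\<^bsub>G\<^esub> z) ` C}"
      using nc[OF V(1) Q V(2)] by blast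
    obtain K where K: "subcontinuum X K" "x0 \<in> K" "y \<in> K" "K \<subseteq> {x \<in> topspace X. ?h x \<in> U}"
      using V(3) y(1) by blast
    have yX: "y \<in> topspace X" using K by auto
    have "?h y \<notin> C"
    proof
      assume "?h y \<in> C"
      moreover have "e y = g \<otimes>\<^bsub>G\<^esub> ?h y" using g eG[OF yX] by (simp add: m_assoc[symmetric])
      ultimately show False using y yX by blast
    qed
    moreover have "compactin T (?h ` K)" "connectedin T (?h ` K)"
      using K(1) image_compactin[OF _ h] connectedin_continuous_map_image[OF h]
      by (auto simp: subcontinuum_def)
    moreover have "?h ` K \<subseteq> U" "?h y \<in> ?h ` K" using K by auto
    moreover have "\<one>\<^bsub>G\<^esub> \<in> ?h ` K" using K(2) h0 by (metis image_eqI)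
    ultimately show ?thesis by (intro exI[of _ "?h y"] exI[of _ "?h ` K"] conjI)
  qed
  have esc: "\<exists>K. compactin T K \<and> \<not> covering_dim_le (subtopology T K) N" for N
    by (rule escape_imp_not_compactly_finite_dim, intro allI impI, elim conjE, rule escape)
  obtain N where N: "(SUP K\<in>{K. compactin T K}. covering_dim (subtopology T K)) = enat N"
    using dim unfolding compactly_finite_dimensional_def by (metis less_infinityE)
  have "covering_dim_le (subtopology T K) N" if "compactin T K" for K
    using that by (intro covering_dim_leD) (auto simp: N[symmetric] intro: SUP_upper)
  moreover obtain K where "compactin T K" "\<not> covering_dim_le (subtopology T K) N"
    using esc[of N] by (elim exE conjE)
  ultimately show False by simp
qed

section \<open>Countable networks and second countability\<close>

text \<open>Members need not be open, unlike those of a base, so the images of basic open sets under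
  a continuous surjection qualify.\<close>

definition network :: "'a topology \<Rightarrow> 'a set set \<Rightarrow> bool" where
  "network X \<N> \<longleftrightarrow> (\<forall>U x. openin X U \<and> x \<in> U \<longrightarrow> (\<exists>N\<in>\<N>. x \<in> N \<and> N \<subseteq> U))"

lemma cosmic_space_countable_network:
  assumes "cosmic_space X"
  shows "\<exists>\<N>. countable \<N> \<and> network X \<N>"
proof -
  obtain M :: "'a topology" and f where M: "metrizable_space M" "separable_space M"
    and f: "continuous_map M X f" "f ` topspace M = topspace X"
    using assms unfolding cosmic_space_def by blast
  obtain \<B> where B: "countable \<B>" "\<And>U x. openin M U \<Longrightarrow> x \<in> U \<Longrightarrow> \<exists>V\<in>\<B>. x \<in> V \<and> V \<subseteq> U"
    using separable_metrizable_imp_second_countable[OF M] unfolding second_countable_def by metis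
  have "\<exists>N\<in>(\<lambda>V. f ` V) ` \<B>. x \<in> N \<and> N \<subseteq> U" if U: "openin X U" "x \<in> U" for U x
  proof -
    obtain z where z: "z \<in> topspace M" "x = f z" using f(2) U openin_subset by blast
    obtain V where "V \<in> \<B>" "z \<in> V" "V \<subseteq> {z \<in> topspace M. f z \<in> U}"
      using B(2)[OF openin_continuous_map_preimage[OF f(1) U(1)], of z] z U(2) by auto
    then show ?thesis using z by auto
  qed
  then show ?thesis using B(1) unfolding network_def
    by (intro exI[of _ "(\<lambda>V. f ` V) ` \<B>"]) auto
qed

text \<open>Every pair of network sets with disjoint open envelopes gets fixed envelopes
  \<open>u\<close> and \<open>v\<close>. Inside a compact neighbourhood of \<open>x\<close>, the
  points outside a given open set around \<open>x\<close> are covered by finitely many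
  \<open>v\<close> sets whose partners \<open>u\<close> contain \<open>x\<close>; so finite
  intersections of \<open>u\<close> sets, cut down by \<open>w M\<close>, form a base.\<close>

lemma locally_compact_network_imp_second_countable:
  assumes lc: "locally_compact_space X" and H: "Hausdorff_space X"
    and N: "countable \<N>" "network X \<N>"
  shows "second_countable X"
proof -
  note net = N(2)[unfolded network_def, rule_format, OF conjI]
  define P where "P = {p \<in> \<N> \<times> \<N>. \<exists>U V. openin X U \<and> openin X V \<and> fst p \<subseteq> U \<and> snd p \<subseteq> V \<and> U \<inter> V = {}}"
  have "\<forall>p\<in>P. \<exists>U V. openin X U \<and> openin X V \<and> fst p \<subseteq> U \<and> snd p \<subseteq> V \<and> U \<inter> V = {}"
    by (simp add: P_def)
  then obtain u v where uv: "\<And>p. p \<in> P \<Longrightarrow> openin X (u p) \<and> openin X (v p) \<and> fst p \<subseteq> u p \<and> snd p \<subseteq> v p \<and> u p \<inter> v p = {}"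
    by metis
  \<comment> \<open>Network sets with an open envelope inside a compact set: countably many of them
    give every point a compact neighbourhood.\<close>
  define Q where "Q = {M \<in> \<N>. \<exists>W K. openin X W \<and> compactin X K \<and> M \<subseteq> W \<and> W \<subseteq> K}"
  have "\<forall>M\<in>Q. \<exists>W K. openin X W \<and> compactin X K \<and> M \<subseteq> W \<and> W \<subseteq> K" by (simp add: Q_def)
  then obtain w k where wk: "\<And>M. M \<in> Q \<Longrightarrow> openin X (w M) \<and> compactin X (k M) \<and> M \<subseteq> w M \<and> w M \<subseteq> k M"
    by metis
  have cP: "countable P" using N(1) by (auto simp: P_def intro: countable_subset[OF _ countable_SIGMA])
  have cQ: "countable Q" using N(1) by (auto simp: Q_def intro: countable_subset)
  define \<B> where "\<B> = (\<lambda>(M, S). w M \<inter> \<Inter>(u ` S)) ` (Q \<times> {S. finite S \<and> S \<subseteq> P})"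
  have "countable \<B>"
    unfolding \<B>_def by (intro countable_image countable_SIGMA cQ countable_Collect_finite_subset cP)
  moreover have "openin X B" if B: "B \<in> \<B>" for B
  proof -
    obtain M S where MS: "M \<in> Q" "finite S" "S \<subseteq> P" "B = w M \<inter> \<Inter>(u ` S)"
      using B by (auto simp: \<B>_def)
    show ?thesis
    proof (cases "S = {}")
      case True
      then show ?thesis using MS wk by simp
    next
      case False
      then have "openin X (\<Inter>(u ` S))" using MS uv by (intro openin_Inter) auto
      then show ?thesis using MS wk by (simp add: openin_Int)
    qed
  qed
  moreover have "\<exists>B\<in>\<B>. x \<in> B \<and> B \<subseteq> W" if W: "openin X W" "x \<in> W" for W x
  proof -
    have xX: "x \<in> topspace X" using W openin_subset by blast
    then obtain W' K where "openin X W'" "compactin X K" "x \<in> W'" "W' \<subseteq> K"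
      using lc unfolding locally_compact_space_def by metis
    moreover from this obtain M where "M \<in> \<N>" "x \<in> M" "M \<subseteq> W'" using net by metis
    ultimately have M: "M \<in> Q" "x \<in> M" unfolding Q_def by blast+
    have K: "compactin X (k M - W)"
    proof -
      have "closedin X (k M)" using H wk M compactin_imp_closedin by metis
      then have "closedin X (k M - W)" using W(1) by blast
      then show ?thesis using closed_compactin wk M by (metis Diff_subset)
    qed
    \<comment> \<open>Hausdorffness separates \<open>x\<close> from \<open>y\<close>, and network
      sets inside the two open sets form a pair in \<open>P\<close>; the envelopes then used are the
      fixed \<open>u\<close> and \<open>v\<close>, not the separating sets.\<close>
    have cov: "k M - W \<subseteq> (\<Union>p\<in>{p \<in> P. x \<in> u p}. v p)"
    proof
      fix y assume y: "y \<in> k M - W"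
      then have yX: "y \<in> topspace X" "x \<noteq> y" using W compactin_subset_topspace[OF K] by auto
      then obtain A B where AB: "openin X A" "openin X B" "x \<in> A" "y \<in> B" "disjnt A B"
        using H xX unfolding Hausdorff_space_def by metis
      obtain N1 where N1: "N1 \<in> \<N>" "x \<in> N1" "N1 \<subseteq> A" using net AB by metis
      obtain N2 where N2: "N2 \<in> \<N>" "y \<in> N2" "N2 \<subseteq> B" using net AB by metis
      have p: "(N1, N2) \<in> P" using AB N1 N2 unfolding P_def disjnt_def by auto
      then have "x \<in> u (N1, N2)" "y \<in> v (N1, N2)" using uv[OF p] N1 N2 by auto
      then show "y \<in> (\<Union>p\<in>{p \<in> P. x \<in> u p}. v p)" using p by blast
    qed
    have "\<forall>p\<in>{p \<in> P. x \<in> u p}. openin X (v p)" using uv by blast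
    from compactin_finite_subindex[OF K this cov]
    obtain S where S: "finite S" "S \<subseteq> {p \<in> P. x \<in> u p}" "k M - W \<subseteq> \<Union>(v ` S)"
      by (elim exE conjE)
    have "w M \<inter> \<Inter>(u ` S) \<in> \<B>" unfolding \<B>_def using S M by (intro image_eqI[of _ _ "(M, S)"]) auto
    moreover have "x \<in> w M \<inter> \<Inter>(u ` S)" using S M wk by auto
    moreover have "w M \<inter> \<Inter>(u ` S) \<subseteq> W"
    proof (rule ccontr)
      assume "\<not> ?thesis"
      then obtain z where z: "z \<in> w M" "z \<notin> W" "\<forall>p\<in>S. z \<in> u p" by blast
      then have "z \<in> k M - W" using wk M by auto
      then obtain p where p: "p \<in> S" "z \<in> v p" using S by blast
      then have "z \<in> u p \<inter> v p" "p \<in> P" using z S by auto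
      then show False using uv by blast
    qed
    ultimately show ?thesis by blast
  qed
  ultimately show ?thesis unfolding second_countable_def by blast
qed

section \<open>Euclidean spaces as topological groups\<close>

lemma continuous_map_Euclidean_coordinate:
  "continuous_map (Euclidean_space m) euclideanreal (\<lambda>x. x i)"
  unfolding Euclidean_space_def
  by (intro continuous_map_from_subtopology continuous_map_product_projection) simp

text \<open>Coordinates from \<open>m\<close> on are free, so the cube becomes a subset of the
  Euclidean space only after intersection.\<close>

definition sup_box :: "nat \<Rightarrow> (nat \<Rightarrow> real) \<Rightarrow> real \<Rightarrow> (nat \<Rightarrow> real) set" where
  "sup_box m x r = {y. \<forall>i<m. \<bar>y i - x i\<bar> < r}"

lemma openin_sup_box: "openin (Euclidean_space m) (topspace (Euclidean_space m) \<inter> sup_box m x r)"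
proof -
  have "openin (Euclidean_space m) {y \<in> topspace (Euclidean_space m). \<forall>i<k. \<bar>y i - x i\<bar> < r}" for k
  proof (induction k)
    case (Suc k)
    have "openin (Euclidean_space m) {y \<in> topspace (Euclidean_space m). y k \<in> {x k - r<..<x k + r}}"
      by (intro openin_continuous_map_preimage[OF continuous_map_Euclidean_coordinate]) simp
    then have "openin (Euclidean_space m) ({y \<in> topspace (Euclidean_space m). \<forall>i<k. \<bar>y i - x i\<bar> < r} \<inter>
        {y \<in> topspace (Euclidean_space m). y k \<in> {x k - r<..<x k + r}})"
      using Suc by blast
    also have "\<dots> = {y \<in> topspace (Euclidean_space m). \<forall>i<Suc k. \<bar>y i - x i\<bar> < r}"
      by (auto simp: less_Suc_eq abs_less_iff)
    finally show ?case .
  qed simp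
  then show ?thesis unfolding sup_box_def by (simp add: Int_def)
qed

lemma sup_box_nhd:
  assumes U: "openin (Euclidean_space m) U" "x \<in> U"
  shows "\<exists>r>0. topspace (Euclidean_space m) \<inter> sup_box m x r \<subseteq> U"
proof -
  obtain S where S: "openin (powertop_real UNIV) S" "U = S \<inter> {x. \<forall>i\<ge>m. x i = 0}"
    using U unfolding Euclidean_space_def openin_subtopology by auto
  then obtain V where V: "\<forall>i. open (V i)" "x \<in> Pi\<^sub>E UNIV V" "Pi\<^sub>E UNIV V \<subseteq> S"
    using U(2) unfolding openin_product_topology_alt by (auto; metis)
  have "\<exists>r>0. \<forall>t. \<bar>t - x i\<bar> < r \<longrightarrow> t \<in> V i" for i
    using V by (metis PiE_mem UNIV_I dist_real_def open_dist)
  then obtain r where r: "\<And>i. r i > 0" "\<And>i t. \<bar>t - x i\<bar> < r i \<Longrightarrow> t \<in> V i" by metis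
  \<comment> \<open>The inserted 1 keeps the minimum meaningful for \<open>m = 0\<close>.\<close>
  define \<rho> where "\<rho> = Min (insert 1 (r ` {..<m}))"
  have "\<rho> > 0" "\<And>i. i < m \<Longrightarrow> \<rho> \<le> r i" using r by (auto simp: \<rho>_def)
  moreover have "y \<in> U" if y: "y \<in> topspace (Euclidean_space m)" "y \<in> sup_box m x \<rho>" for y
  proof -
    have "y i \<in> V i" for i
    proof (cases "i < m")
      case True
      then have "\<bar>y i - x i\<bar> < r i" using y(2) \<open>i < m \<Longrightarrow> \<rho> \<le> r i\<close> by (force simp: sup_box_def)
      then show ?thesis by (rule r)
    next
      case False
      then have "y i = x i" using y(1) U(2) S(2) by (simp add: topspace_Euclidean_space)
      then show ?thesis using V(2) by auto
    qed
    then have "y \<in> S" using V(3) by auto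
    then show ?thesis using S(2) y(1) by (simp add: topspace_Euclidean_space)
  qed
  ultimately show ?thesis by blast
qed

text \<open>Open cubes of radius \<open>h\<close> about the points of the lattice hZ^m refine the
  cover once \<open>h\<close> is small. In each coordinate only two lattice indices are within reach
  of a point, which bounds the multiplicity by \<open>2 ^ m\<close>, whatever \<open>K\<close>
  is.\<close>

lemma covering_dim_le_compactin_Euclidean:
  assumes K: "compactin (Euclidean_space m) K"
  shows "covering_dim_le (subtopology (Euclidean_space m) K) (2 ^ m)"
  unfolding covering_dim_le_def
proof (intro allI impI)
  let ?E = "Euclidean_space m"
  let ?S = "subtopology ?E K"
  fix \<U> assume cov: "finite_open_cover ?S \<U>"
  have KE: "K \<subseteq> topspace ?E" using K by (rule compactin_subset_topspace)
  then have tS: "topspace ?S = K" by auto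
  \<comment> \<open>Boxes of half the good radius form the finite subcover; the other half is the
    margin that makes \<open>\<delta>\<close> a Lebesgue number.\<close>
  have "\<exists>r>0. \<exists>U\<in>\<U>. K \<inter> sup_box m x (2 * r) \<subseteq> U" if x: "x \<in> K" for x
  proof -
    obtain U where U: "U \<in> \<U>" "x \<in> U" "openin ?S U"
      using cov x unfolding finite_open_cover_def tS by blast
    then obtain U' where U': "openin ?E U'" "U = U' \<inter> K" unfolding openin_subtopology by blast
    then obtain r where r: "r > 0" "topspace ?E \<inter> sup_box m x r \<subseteq> U'"
      using sup_box_nhd[OF U'(1)] U(2) by blast
    then have "K \<inter> sup_box m x (2 * (r / 2)) \<subseteq> U" using U'(2) KE by auto
    then show ?thesis using U(1) r(1) half_gt_zero by blast
  qed
  then obtain r where r: "\<And>x. x \<in> K \<Longrightarrow> r x > 0" "\<And>x. x \<in> K \<Longrightarrow> \<exists>U\<in>\<U>. K \<inter> sup_box m x (2 * r x) \<subseteq> U"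
    by metis
  have "K \<subseteq> (\<Union>x\<in>K. topspace ?E \<inter> sup_box m x (r x))"
    using KE r(1) by (force simp: sup_box_def)
  from compactin_finite_subindex[OF K ballI[OF openin_sup_box] this]
  obtain D where D: "finite D" "D \<subseteq> K" "K \<subseteq> (\<Union>x\<in>D. topspace ?E \<inter> sup_box m x (r x))"
    by (elim exE conjE)
  define \<delta> where "\<delta> = Min (insert 1 (r ` D))"
  have \<delta>: "\<delta> > 0" "\<And>x. x \<in> D \<Longrightarrow> \<delta> \<le> r x" using D r(1) by (auto simp: \<delta>_def)
  have leb: "\<exists>U\<in>\<U>. K \<inter> sup_box m z \<delta> \<subseteq> U" if z: "z \<in> K" for z
  proof -
    obtain x where x: "x \<in> D" "z \<in> sup_box m x (r x)" using D z by blast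
    have "sup_box m z \<delta> \<subseteq> sup_box m x (2 * r x)"
    proof
      fix y assume y: "y \<in> sup_box m z \<delta>"
      have "\<bar>y i - x i\<bar> < 2 * r x" if i: "i < m" for i
      proof -
        have "\<bar>y i - z i\<bar> < \<delta>" "\<bar>z i - x i\<bar> < r x" using x(2) y i by (auto simp: sup_box_def)
        then show ?thesis using \<delta>(2)[OF x(1)] by linarith
      qed
      then show "y \<in> sup_box m x (2 * r x)" by (simp add: sup_box_def)
    qed
    then show ?thesis using r(2)[of x] x(1) D(2) by blast
  qed
  \<comment> \<open>Two points of one cube differ by less than \<open>2 * h = \<delta>\<close> in
    each coordinate.\<close>
  define h where "h = \<delta> / 2"
  have h: "h > 0" using \<delta> by (simp add: h_def)
  define Q where "Q z = K \<inter> sup_box m (\<lambda>i. h * real_of_int (z i)) h" for z :: "nat \<Rightarrow> int"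
  have opQ: "openin ?S (Q z)" for z
  proof -
    have "Q z = K \<inter> (topspace ?E \<inter> sup_box m (\<lambda>i. h * real_of_int (z i)) h)" using KE by (auto simp: Q_def)
    then show ?thesis using openin_subtopology_Int2[OF openin_sup_box] by metis
  qed
  \<comment> \<open>Restricting the floors to \<open>{..<m}\<close> gives one extensional index per
    lattice point, so that indices can be counted in a finite product.\<close>
  have inQ: "y \<in> Q (restrict (\<lambda>i. \<lfloor>y i / h\<rfloor>) {..<m})" if "y \<in> K" for y
  proof -
    have "\<bar>y i - h * real_of_int \<lfloor>y i / h\<rfloor>\<bar> < h" for i
    proof -
      have "real_of_int \<lfloor>y i / h\<rfloor> * h \<le> y i" "y i < (real_of_int \<lfloor>y i / h\<rfloor> + 1) * h"
        using h floor_divide_lower floor_divide_upper by blast+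
      then have "h * real_of_int \<lfloor>y i / h\<rfloor> \<le> y i" "y i < h * real_of_int \<lfloor>y i / h\<rfloor> + h"
        by (simp_all add: algebra_simps)
      then show ?thesis by linarith
    qed
    then show ?thesis using that by (auto simp: Q_def sup_box_def)
  qed
  have rng: "z i \<in> {\<lfloor>y i / h\<rfloor>, \<lfloor>y i / h\<rfloor> + 1}" if "y \<in> Q z" "i < m" for y z i
  proof -
    have "\<bar>y i - h * real_of_int (z i)\<bar> < h" using that by (auto simp: Q_def sup_box_def)
    then have "y i / h < real_of_int (z i) + 1" "real_of_int (z i) - 1 < y i / h"
      using h by (auto simp: field_simps abs_less_iff)
    then have "\<lfloor>y i / h\<rfloor> \<le> z i" "z i \<le> \<lfloor>y i / h\<rfloor> + 1" by linarith+
    then show ?thesis by auto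
  qed
  have cover: "K \<subseteq> (\<Union>z\<in>extensional {..<m}. Q z)"
    using inQ by (meson UN_I restrict_extensional subsetI)
  have "compactin ?S K" using K by (simp add: compactin_subtopology)
  from compactin_finite_subindex[OF this ballI[OF opQ] cover]
  obtain Z where Z: "finite Z" "Z \<subseteq> extensional {..<m}" "K \<subseteq> (\<Union>z\<in>Z. Q z)"
    by (elim exE conjE)
  \<comment> \<open>Empty cubes are dropped because the member of \<open>\<U>\<close> around a cube
    is found from a point of the cube.\<close>
  define \<V> where "\<V> = {V \<in> Q ` Z. V \<noteq> {}}"
  have "\<Union>\<V> = (\<Union>z\<in>Z. Q z)" unfolding \<V>_def by blast
  also have "\<dots> = K" using Z(3) by (auto simp: Q_def)
  finally have "\<Union>\<V> = K" .
  then have "finite_open_cover ?S \<V>"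
    unfolding finite_open_cover_def tS using Z(1) opQ by (auto simp: \<V>_def)
  moreover have "\<exists>U\<in>\<U>. V \<subseteq> U" if V: "V \<in> \<V>" for V
  proof -
    obtain z y where z: "V = Q z" "y \<in> Q z" using V by (auto simp: \<V>_def)
    then have y: "y \<in> K" by (auto simp: Q_def)
    have "V \<subseteq> K \<inter> sup_box m y \<delta>"
    proof
      fix x assume x: "x \<in> V"
      have "\<bar>x i - y i\<bar> < \<delta>" if i: "i < m" for i
      proof -
        have "\<bar>x i - h * real_of_int (z i)\<bar> < h" "\<bar>y i - h * real_of_int (z i)\<bar> < h"
          using x z i by (auto simp: Q_def sup_box_def)
        then show ?thesis unfolding h_def by linarith
      qed
      then show "x \<in> K \<inter> sup_box m y \<delta>" using x z(1) by (auto simp: Q_def sup_box_def)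
    qed
    then show ?thesis using leb[OF y] by blast
  qed
  moreover have "card {V\<in>\<V>. y \<in> V} \<le> 2 ^ m + 1" for y
  proof -
    let ?Z = "Pi\<^sub>E {..<m} (\<lambda>i. {\<lfloor>y i / h\<rfloor>, \<lfloor>y i / h\<rfloor> + 1})"
    have "{V\<in>\<V>. y \<in> V} \<subseteq> Q ` ?Z"
    proof
      fix V assume "V \<in> {V\<in>\<V>. y \<in> V}"
      then obtain z where z: "V = Q z" "y \<in> Q z" "z \<in> extensional {..<m}"
        using Z by (auto simp: \<V>_def)
      then have "z \<in> ?Z" using rng[OF z(2)] by (auto simp: PiE_def)
      then show "V \<in> Q ` ?Z" using z by blast
    qed
    moreover have "finite ?Z" by (intro finite_PiE) auto
    ultimately have "card {V\<in>\<V>. y \<in> V} \<le> card ?Z" by (meson surj_card_le)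
    also have "\<dots> = 2 ^ m" by (simp add: card_PiE flip: numeral_2_eq_2)
    finally show ?thesis by simp
  qed
  ultimately show "\<exists>\<V>. finite_open_cover ?S \<V> \<and> (\<forall>V\<in>\<V>. \<exists>U\<in>\<U>. V \<subseteq> U) \<and>
      (\<forall>x\<in>topspace ?S. card {V\<in>\<V>. x \<in> V} \<le> 2 ^ m + 1)"
    by blast
qed

lemma compactly_finite_dimensional_Euclidean: "compactly_finite_dimensional (Euclidean_space m)"
proof -
  have "(SUP K\<in>{K. compactin (Euclidean_space m) K}. covering_dim (subtopology (Euclidean_space m) K)) \<le> enat (2 ^ m)"
    by (intro SUP_least covering_dim_leI covering_dim_le_compactin_Euclidean) simp
  then show ?thesis unfolding compactly_finite_dimensional_def by (rule le_less_trans) simp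
qed

definition Euclidean_group :: "nat \<Rightarrow> (nat \<Rightarrow> real) monoid" where
  "Euclidean_group m = \<lparr>carrier = topspace (Euclidean_space m), mult = (\<lambda>x y i. x i + y i), one = (\<lambda>i. 0)\<rparr>"

lemma topological_group_Euclidean: "topological_group (Euclidean_group m) (Euclidean_space m)"
proof -
  let ?G = "Euclidean_group m" and ?E = "Euclidean_space m"
  have grp: "group ?G"
  proof (rule groupI)
    fix x assume x: "x \<in> carrier ?G"
    then show "\<exists>y\<in>carrier ?G. y \<otimes>\<^bsub>?G\<^esub> x = \<one>\<^bsub>?G\<^esub>"
      by (intro bexI[of _ "\<lambda>i. - x i"]) (auto simp: Euclidean_group_def topspace_Euclidean_space)
  qed (auto simp: Euclidean_group_def topspace_Euclidean_space add.assoc)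
  \<comment> \<open>The inverse is written as a difference from 0 so that continuity of subtraction
    applies.\<close>
  have inv: "inv\<^bsub>?G\<^esub> x = (\<lambda>i. 0 - x i)" if "x \<in> topspace ?E" for x
    using that
    by (intro group.inv_equality[OF grp]) (auto simp: Euclidean_group_def topspace_Euclidean_space)
  have "continuous_map ?E ?E (\<lambda>x i. (\<lambda>_. 0) i - x i)"
    using continuous_map_id[of ?E] topspace_Euclidean_space
    by (intro continuous_map_Euclidean_space_diff) (auto simp: id_def topspace_Euclidean_space)
  then have "continuous_map ?E ?E (\<lambda>x. inv\<^bsub>?G\<^esub> x)"
    by (rule continuous_map_eq) (simp add: inv)
  moreover have "continuous_map (prod_topology ?E ?E) ?E (\<lambda>z i. fst z i + snd z i)"
    by (intro continuous_map_Euclidean_space_add continuous_map_fst continuous_map_snd)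
  then have "continuous_map (prod_topology ?E ?E) ?E (\<lambda>(x, y). x \<otimes>\<^bsub>?G\<^esub> y)"
    by (simp add: Euclidean_group_def case_prod_unfold)
  ultimately show ?thesis
    using grp Hausdorff_Euclidean_space unfolding topological_group_def by (simp add: Euclidean_group_def)
qed

section \<open>General position\<close>

text \<open>Gaussian elimination of the last unknown: a multiple of an equation \<open>s0\<close> in
  which it occurs is subtracted from the others, leaving one equation and one unknown fewer.\<close>

lemma underdetermined_homogeneous_system:
  fixes v :: "'i \<Rightarrow> nat \<Rightarrow> real"
  assumes "finite S" "card S < N"
  shows "\<exists>a. (\<exists>i<N. a i \<noteq> 0) \<and> (\<forall>s\<in>S. (\<Sum>i<N. a i * v s i) = 0)"
  using assms
proof (induction N arbitrary: S v)
  case (Suc N)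
  show ?case
  proof (cases "\<forall>s\<in>S. v s N = 0")
    \<comment> \<open>If the last unknown occurs nowhere, the last unit vector is a
      solution.\<close>
    case True
    then show ?thesis
      by (intro exI[of _ "\<lambda>i. if i = N then 1 else 0"]) (auto simp: if_distrib[of "\<lambda>z. z * _"] cong: if_cong)
  next
    case False
    then obtain s0 where s0: "s0 \<in> S" "v s0 N \<noteq> 0" by blast
    define w where "w s i = v s i - v s N / v s0 N * v s0 i" for s i
    have "card (S - {s0}) < N" using Suc.prems s0 card_Diff1_less[of S s0] by linarith
    then obtain a where a: "\<exists>i<N. a i \<noteq> 0" "\<forall>s\<in>S - {s0}. (\<Sum>i<N. a i * w s i) = 0"
      using Suc.IH[of "S - {s0}" w] Suc.prems by auto
    \<comment> \<open>The value of the last unknown that solves equation \<open>s0\<close>.\<close>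
    define c where "c = - (\<Sum>i<N. a i * v s0 i) / v s0 N"
    define a' where "a' = a(N := c)"
    have eq: "(\<Sum>i<Suc N. a' i * v s i) = (\<Sum>i<N. a i * v s i) + c * v s N" for s
      by (simp add: a'_def)
    have "(\<Sum>i<Suc N. a' i * v s i) = 0" if s: "s \<in> S" for s
    proof (cases "s = s0")
      case True
      then show ?thesis using s0 unfolding eq c_def by simp
    next
      case False
      have "0 = (\<Sum>i<N. a i * w s i)" using a(2) s False by simp
      also have "\<dots> = (\<Sum>i<N. a i * v s i) - v s N / v s0 N * (\<Sum>i<N. a i * v s0 i)"
        by (simp add: w_def algebra_simps sum_subtractf sum_distrib_left)
      also have "\<dots> = (\<Sum>i<N. a i * v s i) + c * v s N" by (simp add: c_def)
      finally show ?thesis unfolding eq by simp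
    qed
    moreover have "\<exists>i<Suc N. a' i \<noteq> 0" using a(1) by (metis a'_def fun_upd_apply less_SucI nat_neq_iff)
    ultimately show ?thesis by blast
  qed
qed simp

text \<open>The point lies on a translate of the moment curve, which meets each hyperplane only finitely often.\<close>

lemma avoid_hyperplanes:
  fixes c :: "nat \<Rightarrow> real"
  assumes H: "finite H" "\<And>a b. (a, b) \<in> H \<Longrightarrow> \<exists>i<m. a i \<noteq> 0" and \<epsilon>: "\<epsilon> > 0"
  shows "\<exists>w. (\<forall>i<m. \<bar>w i - c i\<bar> < \<epsilon>) \<and> (\<forall>(a, b)\<in>H. (\<Sum>i<m. a i * w i) \<noteq> b)"
proof -
  define p where "p t i = c i + t ^ Suc i" for t :: real and i
  have "finite {t. (\<Sum>i<m. a i * p t i) = b}" if ab: "(a, b) \<in> H" for a b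
  proof -
    \<comment> \<open>Coefficients of the polynomial in \<open>t\<close> that results from putting
      \<open>p t\<close> into the equation of the hyperplane; the constant term collects
      \<open>c\<close> and \<open>b\<close>.\<close>
    define d where "d i = (case i of 0 \<Rightarrow> (\<Sum>i<m. a i * c i) - b | Suc j \<Rightarrow> a j)" for i
    have "(\<Sum>i\<le>m. d i * t ^ i) = (\<Sum>i<m. a i * p t i) - b" for t
    proof -
      have "(\<Sum>i\<le>m. d i * t ^ i) = d 0 + (\<Sum>i<m. d (Suc i) * t ^ Suc i)"
        by (simp add: sum.atMost_shift)
      also have "\<dots> = (\<Sum>i<m. a i * p t i) - b"
        by (simp add: d_def p_def algebra_simps sum.distrib)
      finally show ?thesis .
    qed
    then have "{t. (\<Sum>i<m. a i * p t i) = b} = {t. (\<Sum>i\<le>m. d i * t ^ i) = 0}" by auto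
    moreover have "\<exists>i\<le>m. d i \<noteq> 0"
    proof -
      obtain i where "i < m" "a i \<noteq> 0" using H(2)[OF ab] by blast
      then show ?thesis by (intro exI[of _ "Suc i"]) (auto simp: d_def)
    qed
    then have "finite {t. (\<Sum>i\<le>m. d i * t ^ i) = 0}"
      using polyfun_finite_roots[of d m] by blast
    ultimately show ?thesis by simp
  qed
  then have "finite (\<Union>(a, b)\<in>H. {t. (\<Sum>i<m. a i * p t i) = b})" using H(1) by auto
  \<comment> \<open>For \<open>t\<close> below 1 all positive powers are at most \<open>t\<close>,
    so every coordinate moves by less than \<open>\<epsilon>\<close>.\<close>
  moreover have "infinite {0<..<min \<epsilon> 1}" using \<epsilon> by simp
  ultimately obtain t where t: "t \<in> {0<..<min \<epsilon> 1}" "t \<notin> (\<Union>(a, b)\<in>H. {t. (\<Sum>i<m. a i * p t i) = b})"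
    by (metis (no_types, lifting) finite_subset subsetI)
  have "\<bar>p t i - c i\<bar> < \<epsilon>" for i
  proof -
    have "t ^ Suc i \<le> t" "0 \<le> t ^ Suc i" "t < \<epsilon>" using t by (auto simp: mult_left_le power_le_one)
    then show ?thesis unfolding p_def by linarith
  qed
  then show ?thesis using t by (intro exI[of _ "p t"]) auto
qed

text \<open>Affine independence of any at most \<open>m + 1\<close> of the points. The points are
  indexed, so a coincidence under different indices is itself an affine relation.\<close>

definition general_position :: "nat \<Rightarrow> ('i \<Rightarrow> nat \<Rightarrow> real) \<Rightarrow> 'i set \<Rightarrow> bool" where
  "general_position m w \<V> \<longleftrightarrow> (\<forall>S \<alpha>. S \<subseteq> \<V> \<and> card S \<le> Suc m \<and> (\<Sum>V\<in>S. \<alpha> V) = 0 \<and>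
     (\<forall>i<m. (\<Sum>V\<in>S. \<alpha> V * w V i) = 0) \<longrightarrow> (\<forall>V\<in>S. \<alpha> V = 0))"

lemma general_positionD:
  assumes "general_position m w \<V>" "S \<subseteq> \<V>" "card S \<le> Suc m" "(\<Sum>V\<in>S. \<alpha> V) = 0"
    "\<And>i. i < m \<Longrightarrow> (\<Sum>V\<in>S. \<alpha> V * w V i) = 0" "V \<in> S"
  shows "\<alpha> V = 0"
  using assms unfolding general_position_def by blast

text \<open>The normal \<open>a\<close> and the level \<open>b\<close> are \<open>m + 1\<close>
  unknowns subject to at most \<open>m\<close> homogeneous equations. A solution with
  \<open>a = 0\<close> would have \<open>b = 0\<close> too, since \<open>S\<close> is nonempty, and
  so be trivial.\<close>

lemma points_in_hyperplane:
  fixes w :: "'i \<Rightarrow> nat \<Rightarrow> real"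
  assumes "finite S" "S \<noteq> {}" "card S \<le> m"
  shows "\<exists>a b. (\<exists>i<m. a i \<noteq> 0) \<and> (\<forall>V\<in>S. (\<Sum>i<m. a i * w V i) = b)"
proof -
  obtain a where a: "\<exists>i<Suc m. a i \<noteq> 0" "\<forall>s\<in>S. (\<Sum>i<Suc m. a i * (if i < m then w s i else -1)) = 0"
    using underdetermined_homogeneous_system[of S "Suc m" "\<lambda>s i. if i < m then w s i else -1"] assms by auto
  have eq: "(\<Sum>i<m. a i * w V i) = a m" if "V \<in> S" for V
  proof -
    have "(\<Sum>i<Suc m. a i * (if i < m then w V i else -1)) = (\<Sum>i<m. a i * w V i) - a m" by simp
    then show ?thesis using a(2) that by simp
  qed
  moreover have "\<exists>i<m. a i \<noteq> 0"
  proof (rule ccontr)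
    assume *: "\<not> (\<exists>i<m. a i \<noteq> 0)"
    obtain V where "V \<in> S" using assms by blast
    then have "a m = 0" using eq[of V] * by simp
    then show False using a(1) * by (auto simp: less_Suc_eq)
  qed
  ultimately show ?thesis by blast
qed

text \<open>Points are added one at a time, each near its target and off a chosen hyperplane through
  every nonempty set of at most \<open>m\<close> earlier ones. An affine relation involving the new
  point would place it on such a hyperplane.\<close>

lemma general_position_approx:
  fixes c :: "'i \<Rightarrow> nat \<Rightarrow> real"
  assumes "finite \<V>" and \<epsilon>: "\<epsilon> > 0"
  shows "\<exists>w. (\<forall>V\<in>\<V>. \<forall>i<m. \<bar>w V i - c V i\<bar> < \<epsilon>) \<and> general_position m w \<V>"
  using assms(1)
proof (induction \<V>)
  case empty
  then show ?case by (auto simp: general_position_def)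
next
  case (insert V0 \<V>)
  then obtain w where w: "\<forall>V\<in>\<V>. \<forall>i<m. \<bar>w V i - c V i\<bar> < \<epsilon>" "general_position m w \<V>" by blast
  define \<S> where "\<S> = {S. S \<subseteq> \<V> \<and> S \<noteq> {} \<and> card S \<le> m}"
  have finS: "finite \<S>" unfolding \<S>_def using insert.hyps(1) by (simp add: finite_subset[of _ "Pow \<V>"] Collect_mono)
  have "\<exists>p. (\<exists>i<m. fst p i \<noteq> 0) \<and> (\<forall>V\<in>S. (\<Sum>i<m. fst p i * w V i) = (snd p::real))" if "S \<in> \<S>" for S
    using points_in_hyperplane[of S m w] that finite_subset[OF _ insert.hyps(1)] by (auto simp: \<S>_def)
  then obtain h where h: "\<And>S. S \<in> \<S> \<Longrightarrow> (\<exists>i<m. fst (h S) i \<noteq> 0) \<and> (\<forall>V\<in>S. (\<Sum>i<m. fst (h S) i * w V i) = snd (h S))"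
    by metis
  have "\<exists>z. (\<forall>i<m. \<bar>z i - c V0 i\<bar> < \<epsilon>) \<and> (\<forall>(a, b)\<in>h ` \<S>. (\<Sum>i<m. a i * z i) \<noteq> b)"
  proof (rule avoid_hyperplanes[OF finite_imageI[OF finS] _ \<epsilon>])
    fix a b assume "(a, b) \<in> h ` \<S>"
    then show "\<exists>i<m. a i \<noteq> 0" using h by (metis fst_conv imageE)
  qed
  then obtain z where z: "\<forall>i<m. \<bar>z i - c V0 i\<bar> < \<epsilon>" "\<forall>(a, b)\<in>h ` \<S>. (\<Sum>i<m. a i * z i) \<noteq> b" by blast
  define w' where "w' = w(V0 := z)"
  have w'w: "w' V = w V" if "V \<in> \<V>" for V using that insert.hyps(2) by (auto simp: w'_def)
  have "\<forall>V\<in>S. \<alpha> V = 0"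
    if S: "S \<subseteq> insert V0 \<V>" "card S \<le> Suc m" "(\<Sum>V\<in>S. \<alpha> V) = 0" "\<forall>i<m. (\<Sum>V\<in>S. \<alpha> V * w' V i) = 0" for S \<alpha>
  proof -
    define R where "R = S - {V0}"
    have R: "R \<subseteq> \<V>" "finite R" "finite S" "V0 \<notin> R" "R \<subseteq> S"
      using S(1) insert.hyps by (auto simp: R_def dest: finite_subset)
    have \<alpha>0: "\<alpha> V0 = 0" if V0: "V0 \<in> S"
    proof (rule ccontr)
      assume nz: "\<alpha> V0 \<noteq> 0"
      have S_eq: "S = insert V0 R" using V0 by (auto simp: R_def)
      have cR: "card R \<le> m" using S(2) R by (simp add: S_eq)
      have sum0: "\<alpha> V0 + (\<Sum>V\<in>R. \<alpha> V) = 0" using S(3) R by (simp add: S_eq)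
      then have "R \<noteq> {}" using nz by auto
      then have "R \<in> \<S>" using R cR by (simp add: \<S>_def)
      note hR = h[OF this]
      define a b where "a = fst (h R)" and "b = snd (h R)"
      have hyp: "(\<Sum>i<m. a i * w' V i) = b" if "V \<in> R" for V
        using hR that R w'w unfolding a_def b_def by (metis subsetD)
      \<comment> \<open>The functional \<open>a\<close> is applied to the affine relation; it equals
        \<open>b\<close> on the points of \<open>R\<close>, whose coefficients add up to
        \<open>- \<alpha> V0\<close>.\<close>
      have "0 = (\<Sum>i<m. a i * (\<Sum>V\<in>S. \<alpha> V * w' V i))" using S(4) by simp
      also have "\<dots> = (\<Sum>V\<in>S. \<alpha> V * (\<Sum>i<m. a i * w' V i))"
        by (simp add: sum_distrib_left mult.left_commute) (rule sum.swap)
      also have "\<dots> = \<alpha> V0 * (\<Sum>i<m. a i * z i) + (\<Sum>V\<in>R. \<alpha> V * b)"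
        using R hyp by (simp add: S_eq w'_def)
      also have "(\<Sum>V\<in>R. \<alpha> V * b) = - \<alpha> V0 * b"
        using sum0 by (simp add: sum_distrib_right[symmetric] add_eq_0_iff)
      finally have "(\<Sum>i<m. a i * z i) = b" using nz by (simp add: algebra_simps)
      moreover have "(a, b) \<in> h ` \<S>" using \<open>R \<in> \<S>\<close> by (simp add: a_def b_def)
      ultimately show False using z(2) by auto
    qed
    have sumR: "(\<Sum>V\<in>S. \<alpha> V * f V) = (\<Sum>V\<in>R. \<alpha> V * f V)" for f :: "'i \<Rightarrow> real"
      using R \<alpha>0 by (intro sum.mono_neutral_right) (auto simp: R_def)
    have "\<alpha> V = 0" if "V \<in> R" for V
    proof (rule general_positionD[OF w(2) R(1)])
      show "card R \<le> Suc m" using card_mono[OF R(3,5)] S(2) by linarith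
      show "(\<Sum>V\<in>R. \<alpha> V) = 0" using sumR[of "\<lambda>_. 1"] S(3) by simp
      show "(\<Sum>V\<in>R. \<alpha> V * w V i) = 0" if "i < m" for i
      proof -
        have "(\<Sum>V\<in>R. \<alpha> V * w V i) = (\<Sum>V\<in>R. \<alpha> V * w' V i)" using w'w R by (intro sum.cong) auto
        then show ?thesis using sumR[of "\<lambda>V. w' V i"] S(4) that by simp
      qed
    qed (rule that)
    then show ?thesis using \<alpha>0 by (auto simp: R_def)
  qed
  then have "general_position m w' (insert V0 \<V>)" unfolding general_position_def by blast
  moreover have "\<forall>V\<in>insert V0 \<V>. \<forall>i<m. \<bar>w' V i - c V i\<bar> < \<epsilon>" using w(1) z(1) by (auto simp: w'_def)
  ultimately show ?case by blast
qed

section \<open>Embedding into Euclidean space\<close>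

lemma continuous_map_real_uniform_limit:
  fixes f :: "nat \<Rightarrow> 'a \<Rightarrow> real"
  assumes f: "\<And>k. continuous_map X euclideanreal (f k)"
    and le: "\<And>k x. x \<in> topspace X \<Longrightarrow> \<bar>f k x - g x\<bar> \<le> \<eta> k" and \<eta>: "\<eta> \<longlonglongrightarrow> 0"
  shows "continuous_map X euclideanreal g"
proof -
  have "continuous_map X Met_TC.mtopology g"
  proof (rule Met_TC.continuous_map_uniform_limit[where F = sequentially and f = f])
    show "\<forall>\<^sub>F k in sequentially. continuous_map X Met_TC.mtopology (f k)" using f by simp
    show "\<forall>\<^sub>F k in sequentially. \<forall>x\<in>topspace X. g x \<in> UNIV \<and> dist (f k x) (g x) < \<epsilon>" if "\<epsilon> > 0" for \<epsilon> :: real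
      using order_tendstoD(2)[OF \<eta> that]
    proof eventually_elim
      case (elim k)
      then show ?case using le_less_trans[OF le[of _ k] elim] by (simp add: dist_real_def)
    qed
  qed simp
  then show ?thesis by simp
qed

text \<open>Urysohn functions that are 1 on a closed shrinking and 0 off the members are divided by
  their sum; the shrinking still covers, so the sum is positive.\<close>

lemma partition_of_unity_finite_cover:
  assumes X: "normal_space X" and cov: "finite_open_cover X \<V>"
  shows "\<exists>\<phi>. (\<forall>V\<in>\<V>. continuous_map X euclideanreal (\<phi> V) \<and>
      (\<forall>x\<in>topspace X. 0 \<le> \<phi> V x \<and> (x \<notin> V \<longrightarrow> \<phi> V x = 0))) \<and>
    (\<forall>x\<in>topspace X. (\<Sum>V\<in>\<V>. \<phi> V x) = (1::real))"
proof -
  have V: "finite \<V>" "\<forall>V\<in>\<V>. openin X V" "\<Union>\<V> = topspace X"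
    using cov by (auto simp: finite_open_cover_def)
  obtain F where F: "\<forall>V\<in>\<V>. closedin X (F V) \<and> F V \<subseteq> V" "topspace X \<subseteq> (\<Union>V\<in>\<V>. F V)"
    using finite_cover_shrink[OF X V(1,2) closedin_topspace] V(3) by auto
  have "\<exists>u. continuous_map X euclideanreal u \<and> (\<forall>x\<in>topspace X. 0 \<le> u x \<and> (x \<notin> V \<longrightarrow> u x = 0)) \<and>
      (\<forall>x\<in>F V. u x = 1)" if V1: "V \<in> \<V>" for V
  proof -
    have "closedin X (topspace X - V)" "closedin X (F V)" "disjnt (topspace X - V) (F V)"
      using V F V1 by (auto simp: disjnt_def)
    then obtain u where u: "continuous_map X (top_of_set {0..1}) u" "u ` (topspace X - V) \<subseteq> {0::real}" "u ` F V \<subseteq> {1}"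
      using Urysohn_lemma[OF X, of "topspace X - V" "F V" 0 1] by auto
    then have "continuous_map X euclideanreal u" "\<forall>x\<in>topspace X. 0 \<le> u x"
      by (auto simp: continuous_map_in_subtopology Pi_iff)
    then show ?thesis using u(2,3) by (intro exI[of _ u]) auto
  qed
  then obtain u where u: "\<And>V. V \<in> \<V> \<Longrightarrow> continuous_map X euclideanreal (u V) \<and>
      (\<forall>x\<in>topspace X. 0 \<le> u V x \<and> (x \<notin> V \<longrightarrow> u V x = (0::real))) \<and> (\<forall>x\<in>F V. u V x = 1)" by metis
  define s where "s x = (\<Sum>V\<in>\<V>. u V x)" for x
  have s: "s x > 0" if x: "x \<in> topspace X" for x
  proof -
    obtain V where V1: "V \<in> \<V>" "x \<in> F V" using F(2) x by blast
    then have "1 = u V x" using u by auto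
    also have "\<dots> \<le> s x" unfolding s_def using V1 V(1) u x by (intro member_le_sum) auto
    finally show ?thesis by linarith
  qed
  have cs: "continuous_map X euclideanreal s"
    unfolding s_def using u V(1) by (intro continuous_map_sum) auto
  have "continuous_map X euclideanreal (\<lambda>x. u V x / s x)" if "V \<in> \<V>" for V
    using u[OF that] cs s by (intro continuous_map_real_divide) force+
  moreover have "(\<Sum>V\<in>\<V>. u V x / s x) = 1" if "x \<in> topspace X" for x
    using s[OF that] by (simp add: sum_divide_distrib[symmetric] s_def[symmetric])
  moreover have "0 \<le> u V x / s x \<and> (x \<notin> V \<longrightarrow> u V x / s x = 0)" if "V \<in> \<V>" "x \<in> topspace X" for V x
    using u[OF that(1)] s[OF that(2)] that(2) by auto
  ultimately show ?thesis by (intro exI[of _ "\<lambda>V x. u V x / s x"]) simp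
qed

section \<open>Separating disjoint compact sets by perturbation\<close>

text \<open>On \<open>P \<union> Q\<close> the new map is a combination of points in general
  position, weighted by a partition of unity with at most \<open>n + 1\<close> nonzero weights at
  each point. A point of \<open>P\<close> and one of \<open>Q\<close> use disjoint sets of members,
  together at most \<open>2 * n + 2 = m + 1\<close>, so equal images would be a forbidden affine
  relation.\<close>

lemma perturb_to_separate:
  fixes f :: "nat \<Rightarrow> 'a \<Rightarrow> real"
  assumes X: "normal_space X" and dim: "covering_dim_le X n" and m: "m = 2 * n + 1"
    and f: "\<And>i. i < m \<Longrightarrow> continuous_map X euclideanreal (f i)"
    and P: "compactin X P" "closedin X P" and Q: "compactin X Q" "closedin X Q" and PQ: "P \<inter> Q = {}"
    and \<epsilon>: "\<epsilon> > 0"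
  shows "\<exists>g. (\<forall>i<m. continuous_map X euclideanreal (g i) \<and> (\<forall>x\<in>topspace X. \<bar>g i x - f i x\<bar> \<le> \<epsilon>)) \<and>
    (\<forall>x\<in>P. \<forall>y\<in>Q. \<exists>i<m. g i x \<noteq> g i y)"
proof -
  have sub: "P \<subseteq> topspace X" "Q \<subseteq> topspace X" using P Q closedin_subset by auto
  \<comment> \<open>With a quarter, values of \<open>f\<close> within one \<open>B x\<close> differ
    by less than \<open>2 * \<delta> = \<epsilon> / 2\<close>, which leaves
    \<open>\<epsilon> / 2\<close> for moving the points.\<close>
  define \<delta> where "\<delta> = \<epsilon> / 4"
  define B where "B x = {y \<in> topspace X. \<forall>i<m. \<bar>f i y - f i x\<bar> < \<delta>}" for x
  have opB: "openin X (B x)" for x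
  proof -
    have "openin X {y \<in> topspace X. \<forall>i<k. \<bar>f i y - f i x\<bar> < \<delta>}" if "k \<le> m" for k
      using that
    proof (induction k)
      case (Suc k)
      have "openin X {y \<in> topspace X. f k y \<in> {f k x - \<delta><..<f k x + \<delta>}}"
        using Suc.prems by (intro openin_continuous_map_preimage[OF f]) simp_all
      moreover have "openin X {y \<in> topspace X. \<forall>i<k. \<bar>f i y - f i x\<bar> < \<delta>}" using Suc by simp
      ultimately have "openin X ({y \<in> topspace X. \<forall>i<k. \<bar>f i y - f i x\<bar> < \<delta>} \<inter>
          {y \<in> topspace X. f k y \<in> {f k x - \<delta><..<f k x + \<delta>}})" by blast
      also have "\<dots> = {y \<in> topspace X. \<forall>i<Suc k. \<bar>f i y - f i x\<bar> < \<delta>}"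
        by (auto simp: less_Suc_eq abs_less_iff)
      finally show ?case .
    qed simp
    then show ?thesis by (simp add: B_def)
  qed
  \<comment> \<open>Each set misses \<open>P\<close> or \<open>Q\<close>, so no member of the
    refinement can meet both.\<close>
  define U where "U x = (if x \<in> P then B x - Q else B x - P)" for x
  have opU: "\<forall>x\<in>P \<union> Q. openin X (U x)" using opB P Q by (auto simp: U_def)
  have "compactin X (P \<union> Q)" using P Q by (simp add: compactin_Un)
  moreover have "P \<union> Q \<subseteq> (\<Union>x\<in>P \<union> Q. U x)"
  proof
    fix x assume x: "x \<in> P \<union> Q"
    then have "x \<in> B x" using sub \<epsilon> by (auto simp: B_def \<delta>_def)
    then have "x \<in> U x" using x PQ by (auto simp: U_def)
    then show "x \<in> (\<Union>x\<in>P \<union> Q. U x)" using x by blast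
  qed
  ultimately obtain D where D: "finite D" "D \<subseteq> P \<union> Q" "P \<union> Q \<subseteq> (\<Union>x\<in>D. U x)"
    using compactin_finite_subindex[OF _ opU] by (metis (no_types, lifting))
  have Usub: "U x \<subseteq> topspace X" for x by (auto simp: U_def B_def)
  have "closedin X (P \<union> Q)" using P Q by blast
  then have "openin X (topspace X - (P \<union> Q))" by blast
  then have "finite_open_cover X (insert (topspace X - (P \<union> Q)) (U ` D))"
    unfolding finite_open_cover_def using D opU Usub sub by auto
  from dim[unfolded covering_dim_le_def, THEN spec, THEN mp, OF this]
  obtain \<V> where V: "finite_open_cover X \<V>"
      "\<forall>V\<in>\<V>. \<exists>W\<in>insert (topspace X - (P \<union> Q)) (U ` D). V \<subseteq> W"
      "\<forall>x\<in>topspace X. card {V\<in>\<V>. x \<in> V} \<le> n + 1"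
    by (elim exE conjE)
  have finV: "finite \<V>" and VX: "\<And>V. V \<in> \<V> \<Longrightarrow> V \<subseteq> topspace X"
    using V(1) by (auto simp: finite_open_cover_def)
  obtain \<phi> where \<phi>0: "(\<forall>V\<in>\<V>. continuous_map X euclideanreal (\<phi> V) \<and>
      (\<forall>x\<in>topspace X. 0 \<le> \<phi> V x \<and> (x \<notin> V \<longrightarrow> \<phi> V x = 0))) \<and>
    (\<forall>x\<in>topspace X. (\<Sum>V\<in>\<V>. \<phi> V x) = (1::real))"
    using partition_of_unity_finite_cover[OF X V(1)] by (rule exE)
  have \<phi>: "continuous_map X euclideanreal (\<phi> V)" "x \<in> topspace X \<Longrightarrow> 0 \<le> \<phi> V x"
      "x \<in> topspace X \<Longrightarrow> x \<notin> V \<Longrightarrow> \<phi> V x = 0" if "V \<in> \<V>" for V x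
    using \<phi>0 that by auto
  have \<phi>1: "(\<Sum>V\<in>\<V>. \<phi> V x) = 1" if "x \<in> topspace X" for x using \<phi>0 that by auto
  \<comment> \<open>A member that misses \<open>P \<union> Q\<close> may be large, with no bound on
    the oscillation of \<open>f\<close>; for such members \<open>g\<close> keeps \<open>f\<close>
    itself.\<close>
  define \<W> where "\<W> = {V \<in> \<V>. V \<inter> (P \<union> Q) \<noteq> {}}"
  have WU: "\<exists>d\<in>D. V \<subseteq> U d" if "V \<in> \<W>" for V
    using V(2) that by (auto simp: \<W>_def)
  define c where "c V = (SOME x. x \<in> V)" for V :: "'a set"
  have c: "c V \<in> V" if "V \<in> \<W>" for V
    using that unfolding c_def \<W>_def by (auto intro: someI)
  have osc: "\<bar>f i x - f i (c V)\<bar> < \<epsilon> / 2" if V1: "V \<in> \<W>" "x \<in> V" "i < m" for V x i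
  proof -
    obtain d where "V \<subseteq> U d" using WU V1 by blast
    then have "V \<subseteq> B d" by (auto simp: U_def split: if_splits)
    then have "x \<in> B d" "c V \<in> B d" using V1 c by auto
    then have "\<bar>f i x - f i d\<bar> < \<delta>" "\<bar>f i (c V) - f i d\<bar> < \<delta>" using V1 by (auto simp: B_def)
    then show ?thesis unfolding \<delta>_def by linarith
  qed
  have finW: "finite \<W>" using finV by (simp add: \<W>_def)
  have "\<epsilon> / 2 > 0" using \<epsilon> by simp
  from general_position_approx[OF finW this, of m "\<lambda>V i. f i (c V)"]
  obtain w where w: "\<forall>V\<in>\<W>. \<forall>i<m. \<bar>w V i - f i (c V)\<bar> < \<epsilon> / 2" "general_position m w \<W>"
    by (elim exE conjE)
  define g where "g i x = (\<Sum>V\<in>\<V>. \<phi> V x * (if V \<in> \<W> then w V i else f i x))" for i x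
  have "continuous_map X euclideanreal (g i)" if i: "i < m" for i
  proof -
    have "continuous_map X euclideanreal (\<lambda>x. \<phi> V x * (if V \<in> \<W> then w V i else f i x))" if "V \<in> \<V>" for V
      using \<phi>(1)[OF that] f[OF i] by (cases "V \<in> \<W>") (auto intro: continuous_map_real_mult)
    then show ?thesis unfolding g_def using finV by (intro continuous_map_sum) auto
  qed
  moreover have "\<bar>g i x - f i x\<bar> \<le> \<epsilon>" if i: "i < m" and x: "x \<in> topspace X" for i x
  proof -
    have "g i x - f i x = (\<Sum>V\<in>\<V>. \<phi> V x * (if V \<in> \<W> then w V i else f i x)) - (\<Sum>V\<in>\<V>. \<phi> V x) * f i x"
      using \<phi>1[OF x] by (simp add: g_def)
    also have "\<dots> = (\<Sum>V\<in>\<V>. \<phi> V x * ((if V \<in> \<W> then w V i else f i x) - f i x))"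
      by (simp add: sum_distrib_right sum_subtractf right_diff_distrib)
    finally have "\<bar>g i x - f i x\<bar> \<le> (\<Sum>V\<in>\<V>. \<bar>\<phi> V x * ((if V \<in> \<W> then w V i else f i x) - f i x)\<bar>)"
      by (metis sum_abs)
    also have "\<dots> \<le> (\<Sum>V\<in>\<V>. \<phi> V x * \<epsilon>)"
    proof (rule sum_mono)
      fix V assume V1: "V \<in> \<V>"
      show "\<bar>\<phi> V x * ((if V \<in> \<W> then w V i else f i x) - f i x)\<bar> \<le> \<phi> V x * \<epsilon>"
      proof (cases "V \<in> \<W> \<and> x \<in> V")
        case True
        then have "\<bar>f i x - f i (c V)\<bar> < \<epsilon> / 2" "\<bar>w V i - f i (c V)\<bar> < \<epsilon> / 2" using osc w(1) i by auto
        then have "\<bar>w V i - f i x\<bar> \<le> \<epsilon>" by linarith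
        then show ?thesis using True \<phi>(2)[OF V1 x] by (simp add: abs_mult mult_left_mono)
      next
        case False
        then show ?thesis using \<phi>(2,3)[OF V1 x] \<epsilon> by auto
      qed
    qed
    also have "\<dots> = \<epsilon>" using \<phi>1[OF x] by (simp add: sum_distrib_right[symmetric])
    finally show ?thesis .
  qed
  moreover have "\<exists>i<m. g i x \<noteq> g i y" if xy: "x \<in> P" "y \<in> Q" for x y
  proof (rule ccontr)
    assume "\<not> (\<exists>i<m. g i x \<noteq> g i y)"
    then have eq: "g i x = g i y" if "i < m" for i using that by blast
    have tx: "x \<in> topspace X" and ty: "y \<in> topspace X" using xy sub by auto
    define Sx where "Sx = {V\<in>\<V>. x \<in> V}"
    define Sy where "Sy = {V\<in>\<V>. y \<in> V}"
    have SW: "Sx \<union> Sy \<subseteq> \<W>" using xy by (auto simp: Sx_def Sy_def \<W>_def)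
    have fin: "finite Sx" "finite Sy" using finV by (auto simp: Sx_def Sy_def)
    have disj: "Sx \<inter> Sy = {}"
    proof (rule equals0I)
      fix V assume V1: "V \<in> Sx \<inter> Sy"
      then obtain d where "V \<subseteq> U d" using WU SW by blast
      then have "x \<in> U d" "y \<in> U d" using V1 by (auto simp: Sx_def Sy_def)
      then show False using xy PQ by (auto simp: U_def split: if_splits)
    qed
    define \<alpha> where "\<alpha> V = \<phi> V x - \<phi> V y" for V
    have \<alpha>sum: "(\<Sum>V\<in>Sx \<union> Sy. \<alpha> V * h V) = (\<Sum>V\<in>\<V>. \<phi> V x * h V) - (\<Sum>V\<in>\<V>. \<phi> V y * h V)" for h
    proof -
      have "(\<Sum>V\<in>Sx \<union> Sy. \<alpha> V * h V) = (\<Sum>V\<in>\<V>. \<alpha> V * h V)"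
        using finV \<phi>(3) tx ty by (intro sum.mono_neutral_left) (auto simp: Sx_def Sy_def \<alpha>_def)
      then show ?thesis by (simp add: \<alpha>_def left_diff_distrib sum_subtractf)
    qed
    have gW: "g i z = (\<Sum>V\<in>\<V>. \<phi> V z * w V i)" if z: "z \<in> P \<union> Q" for i z
      unfolding g_def
    proof (rule sum.cong[OF refl])
      fix V assume V1: "V \<in> \<V>"
      have "z \<in> topspace X" using z sub by auto
      moreover have "z \<notin> V" if "V \<notin> \<W>" using that V1 z by (auto simp: \<W>_def)
      ultimately show "\<phi> V z * (if V \<in> \<W> then w V i else f i z) = \<phi> V z * w V i"
        using \<phi>(3)[OF V1] by auto
    qed
    have \<alpha>0: "\<alpha> V = 0" if "V \<in> Sx \<union> Sy" for V
    proof (rule general_positionD[OF w(2) SW])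
      have "card (Sx \<union> Sy) \<le> card Sx + card Sy" by (rule card_Un_le)
      also have "\<dots> \<le> (n + 1) + (n + 1)" using V(3) tx ty unfolding Sx_def Sy_def by (intro add_mono) auto
      finally show "card (Sx \<union> Sy) \<le> Suc m" by (simp add: m)
      show "(\<Sum>V\<in>Sx \<union> Sy. \<alpha> V) = 0" using \<alpha>sum[of "\<lambda>_. 1"] \<phi>1[OF tx] \<phi>1[OF ty] by simp
      show "(\<Sum>V\<in>Sx \<union> Sy. \<alpha> V * w V i) = 0" if "i < m" for i
        using \<alpha>sum[of "\<lambda>V. w V i"] gW[of x i] gW[of y i] eq[OF that] xy by auto
    qed (rule that)
    \<comment> \<open>As \<open>Sx\<close> and \<open>Sy\<close> are disjoint, a vanishing
      coefficient means a vanishing weight at \<open>x\<close>; but the weights at \<open>x\<close>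
      add up to 1.\<close>
    have "\<phi> V x = 0" if V1: "V \<in> \<V>" for V
    proof (cases "x \<in> V")
      case True
      then have "V \<in> Sx" using V1 by (simp add: Sx_def)
      then have "\<alpha> V = 0" "V \<notin> Sy" using \<alpha>0 disj by auto
      then show ?thesis using \<phi>(3)[OF V1 ty] V1 by (simp add: \<alpha>_def Sy_def)
    qed (use \<phi>(3)[OF V1 tx] in simp)
    then show False using \<phi>1[OF tx] by simp
  qed
  ultimately show ?thesis by blast
qed

text \<open>The sum of the coordinate distances attains a positive minimum \<open>d\<close> on the
  compact set \<open>P \<times> Q\<close>, and a change by \<open>\<eta>\<close> in every coordinate
  lowers it by at most \<open>2 * m * \<eta>\<close>.\<close>

lemma separation_is_robust:
  fixes f :: "nat \<Rightarrow> 'a \<Rightarrow> real"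
  assumes f: "\<And>i. i < m \<Longrightarrow> continuous_map X euclideanreal (f i)"
    and P: "compactin X P" and Q: "compactin X Q"
    and sep: "\<forall>x\<in>P. \<forall>y\<in>Q. \<exists>i<m. f i x \<noteq> f i y"
  shows "\<exists>\<eta>>0. \<forall>g. (\<forall>i<m. \<forall>x\<in>topspace X. \<bar>g i x - f i x\<bar> \<le> \<eta>) \<longrightarrow> (\<forall>x\<in>P. \<forall>y\<in>Q. \<exists>i<m. g i x \<noteq> g i y)"
proof (cases "P = {} \<or> Q = {}")
  case True
  then show ?thesis by (intro exI[of _ 1]) auto
next
  case False
  have sub: "P \<subseteq> topspace X" "Q \<subseteq> topspace X" using P Q compactin_subset_topspace by auto
  let ?D = "\<lambda>z. \<Sum>i<m. \<bar>f i (fst z) - f i (snd z)\<bar>"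
  have c1: "continuous_map (prod_topology X X) euclideanreal (\<lambda>z. f i (fst z))" if "i < m" for i
    using continuous_map_compose[OF continuous_map_fst f[OF that]] by (simp add: o_def)
  have c2: "continuous_map (prod_topology X X) euclideanreal (\<lambda>z. f i (snd z))" if "i < m" for i
    using continuous_map_compose[OF continuous_map_snd f[OF that]] by (simp add: o_def)
  have "continuous_map (prod_topology X X) euclideanreal ?D"
    using c1 c2 by (intro continuous_map_sum continuous_map_real_abs continuous_map_diff) auto
  then have "compactin euclideanreal (?D ` (P \<times> Q))"
    using P Q by (intro image_compactin) (auto simp: compactin_Times)
  then have "compact (?D ` (P \<times> Q))" by simp
  moreover have "?D ` (P \<times> Q) \<noteq> {}" using False by auto
  ultimately obtain d where d: "d \<in> ?D ` (P \<times> Q)" "\<forall>t\<in>?D ` (P \<times> Q). d \<le> t"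
    using compact_attains_inf by blast
  have "d > 0"
  proof -
    obtain x y where xy: "x \<in> P" "y \<in> Q" "d = (\<Sum>i<m. \<bar>f i x - f i y\<bar>)" using d(1) by auto
    then obtain i where i: "i < m" "f i x \<noteq> f i y" using sep by blast
    then have "0 < \<bar>f i x - f i y\<bar>" by simp
    also have "\<dots> \<le> d" unfolding xy(3) using i by (intro member_le_sum) auto
    finally show ?thesis .
  qed
  \<comment> \<open>The \<open>+ 1\<close> keeps the denominator positive and
    \<open>2 * real m * \<eta>\<close> strictly below \<open>d\<close>.\<close>
  define \<eta> where "\<eta> = d / (2 * (real m + 1))"
  have \<eta>: "\<eta> > 0" "2 * real m * \<eta> < d" using \<open>d > 0\<close> by (auto simp: \<eta>_def field_simps)
  have "\<exists>i<m. g i x \<noteq> g i y"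
    if g: "\<forall>i<m. \<forall>x\<in>topspace X. \<bar>g i x - f i x\<bar> \<le> \<eta>" and xy: "x \<in> P" "y \<in> Q" for g x y
  proof (rule ccontr)
    assume "\<not> ?thesis"
    then have eq: "g i x = g i y" if "i < m" for i using that by blast
    have "\<bar>f i x - f i y\<bar> \<le> 2 * \<eta>" if "i < m" for i
    proof -
      have "\<bar>g i x - f i x\<bar> \<le> \<eta>" "\<bar>g i y - f i y\<bar> \<le> \<eta>" using g that xy sub by auto
      then show ?thesis using eq[OF that] by linarith
    qed
    then have "(\<Sum>i<m. \<bar>f i x - f i y\<bar>) \<le> (\<Sum>i<m. 2 * \<eta>)" by (intro sum_mono) auto
    moreover have "d \<le> (\<Sum>i<m. \<bar>f i x - f i y\<bar>)" using d(2) xy by force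
    ultimately show False using \<eta>(2) by simp
  qed
  then show ?thesis using \<eta>(1) by blast
qed

section \<open>Compact pairs and exhaustion functions\<close>

text \<open>Local compactness shrinks disjoint neighbourhoods of two points to basic sets with
  compact closures, and there are only countably many pairs of these.\<close>

lemma separating_compact_pairs:
  assumes lc: "locally_compact_space X" and H: "Hausdorff_space X" and sc: "second_countable X"
  shows "\<exists>P Q :: nat \<Rightarrow> 'a set. (\<forall>k. compactin X (P k) \<and> compactin X (Q k) \<and> P k \<inter> Q k = {}) \<and>
    (\<forall>x\<in>topspace X. \<forall>y\<in>topspace X. x \<noteq> y \<longrightarrow> (\<exists>k. x \<in> P k \<and> y \<in> Q k))"
proof -
  obtain \<B> where B: "countable \<B>" "\<And>V. V \<in> \<B> \<Longrightarrow> openin X V"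
      "\<And>U x. openin X U \<Longrightarrow> x \<in> U \<Longrightarrow> \<exists>V\<in>\<B>. x \<in> V \<and> V \<subseteq> U"
    using sc unfolding second_countable_def by metis
  define cl where "cl V = Abstract_Topology.closure_of X V" for V
  \<comment> \<open>The empty pair makes the set nonempty, so that \<open>from_nat_into\<close>
    enumerates it.\<close>
  define \<P> where "\<P> = insert ({}, {}) {p \<in> cl ` \<B> \<times> cl ` \<B>. compactin X (fst p) \<and> compactin X (snd p) \<and> fst p \<inter> snd p = {}}"
  have "\<P> \<subseteq> insert ({}, {}) (cl ` \<B> \<times> cl ` \<B>)" by (auto simp: \<P>_def)
  then have cP: "countable \<P>" by (rule countable_subset) (use B(1) in simp)
  define p where "p = from_nat_into \<P>"
  have p: "p k \<in> \<P>" for k unfolding p_def by (rule from_nat_into) (simp add: \<P>_def)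
  have nb: "\<exists>V\<in>\<B>. x \<in> cl V \<and> cl V \<subseteq> U \<and> compactin X (cl V)" if U: "openin X U" "x \<in> U" for U x
  proof -
    have "neighbourhood_base_of (\<lambda>C. compactin X C \<and> closedin X C) X"
      using lc locally_compact_space_neighbourhood_base_closedin H by blast
    then obtain W C where WC: "openin X W" "compactin X C" "closedin X C" "x \<in> W" "W \<subseteq> C" "C \<subseteq> U"
      using U unfolding neighbourhood_base_of by metis
    obtain V where V: "V \<in> \<B>" "x \<in> V" "V \<subseteq> W" using B(3) WC by metis
    have "cl V \<subseteq> C" unfolding cl_def using closure_of_minimal V(3) WC by (metis subset_trans)
    moreover have "V \<subseteq> cl V" unfolding cl_def using closure_of_subset openin_subset B(2) V(1) by metis
    moreover have "closedin X (cl V)" unfolding cl_def by (rule closedin_closure_of)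
    ultimately show ?thesis using V WC closed_compactin by (metis subsetD subset_trans)
  qed
  have "\<exists>k. x \<in> fst (p k) \<and> y \<in> snd (p k)" if xy: "x \<in> topspace X" "y \<in> topspace X" "x \<noteq> y" for x y
  proof -
    obtain U V where UV: "openin X U" "openin X V" "x \<in> U" "y \<in> V" "disjnt U V"
      using H xy unfolding Hausdorff_space_def by metis
    obtain A where A: "A \<in> \<B>" "x \<in> cl A" "cl A \<subseteq> U" "compactin X (cl A)" using nb UV by metis
    obtain C where C: "C \<in> \<B>" "y \<in> cl C" "cl C \<subseteq> V" "compactin X (cl C)" using nb UV by metis
    have "(cl A, cl C) \<in> \<P>" unfolding \<P>_def using A C UV(5) by (auto simp: disjnt_def)
    then obtain k where "p k = (cl A, cl C)" unfolding p_def using cP from_nat_into_surj by metis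
    then show ?thesis using A C by (intro exI[of _ k]) simp
  qed
  moreover have "compactin X (fst (p k)) \<and> compactin X (snd (p k)) \<and> fst (p k) \<inter> snd (p k) = {}" for k
    using p[of k] by (auto simp: \<P>_def)
  ultimately show ?thesis by (intro exI[of _ "fst \<circ> p"] exI[of _ "snd \<circ> p"]) simp
qed

text \<open>A positive sum \<open>h\<close> of bumps with values in [0,1] and geometric weights,
  each bump vanishing off a compact set, is small off finitely many of these sets; the function
  sought is its reciprocal.\<close>

lemma exists_exhaustion_function:
  assumes lc: "locally_compact_space X" and H: "Hausdorff_space X" and sc: "second_countable X"
  shows "\<exists>g. continuous_map X euclideanreal g \<and> (\<forall>r. \<exists>K. compactin X K \<and> {x \<in> topspace X. g x \<le> r} \<subseteq> K)"
proof (cases "topspace X = {}")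
  case True
  then show ?thesis by (intro exI[of _ "\<lambda>_. 0"] conjI allI exI[of _ "{}"]) auto
next
  case False
  have "regular_space X" using lc H locally_compact_Hausdorff_imp_regular_space by blast
  then have cr: "completely_regular_space X"
    using lc locally_compact_regular_imp_completely_regular_space by blast
  have "\<exists>u K. continuous_map X euclideanreal u \<and> compactin X K \<and> u x > 0 \<and>
      (\<forall>y\<in>topspace X. 0 \<le> u y \<and> u y \<le> 1 \<and> (y \<notin> K \<longrightarrow> u y = (0::real)))" if x: "x \<in> topspace X" for x
  proof -
    obtain W K where WK: "openin X W" "compactin X K" "x \<in> W" "W \<subseteq> K"
      using lc x unfolding locally_compact_space_def by metis
    have "closedin X (topspace X - W)" "x \<in> topspace X - (topspace X - W)" using WK x by auto
    then obtain v :: "'a \<Rightarrow> real" where v: "continuous_map X (top_of_set {0..1}) v" "v x = 0" "v ` (topspace X - W) \<subseteq> {1}"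
      using cr unfolding completely_regular_space_def by metis
    have v': "continuous_map X euclideanreal v" "\<forall>y\<in>topspace X. v y \<in> {0..1}"
      using v(1) by (auto simp: continuous_map_in_subtopology)
    show ?thesis
    proof (intro exI[of _ "\<lambda>y. 1 - v y"] exI[of _ K] conjI ballI impI)
      show "continuous_map X euclideanreal (\<lambda>y. 1 - v y)" using v'(1) by (intro continuous_map_diff) auto
      show "1 - v y = 0" if "y \<in> topspace X" "y \<notin> K" for y using v(3) WK(4) that by auto
    qed (use WK v v' in auto)
  qed
  then obtain u K where uK: "\<And>x. x \<in> topspace X \<Longrightarrow> continuous_map X euclideanreal (u x) \<and> compactin X (K x) \<and> u x x > 0 \<and>
      (\<forall>y\<in>topspace X. 0 \<le> u x y \<and> u x y \<le> 1 \<and> (y \<notin> K x \<longrightarrow> u x y = (0::real)))" by metis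
  define W where "W x = {y \<in> topspace X. u x y \<in> {0<..}}" for x
  have W: "openin X (W x)" "x \<in> W x" if "x \<in> topspace X" for x
    using uK[OF that] openin_continuous_map_preimage[of X euclideanreal "u x" "{0<..}"] that by (auto simp: W_def)
  have "Lindelof_space X" using sc second_countable_imp_Lindelof_space by blast
  moreover have "\<forall>V\<in>W ` topspace X. openin X V" "\<Union>(W ` topspace X) = topspace X"
    using W by (auto simp: W_def[of _, symmetric] dest: openin_subset) 
  ultimately obtain \<V> where V: "countable \<V>" "\<V> \<subseteq> W ` topspace X" "\<Union>\<V> = topspace X"
    unfolding Lindelof_space_def by meson
  from countable_subset_image[THEN iffD1, OF conjI[OF V(1,2)]]
  obtain C where C: "countable C" "C \<subseteq> topspace X" "\<V> = W ` C" by (elim exE conjE)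
  have "C \<noteq> {}"
  proof
    assume "C = {}"
    then have "topspace X = {}" using V(3) C(3) by simp
    then show False using False by simp
  qed
  \<comment> \<open>The enumeration may repeat points, which only changes the weights.\<close>
  define s where "s = from_nat_into C"
  have s: "s k \<in> topspace X" for k
    using from_nat_into[OF \<open>C \<noteq> {}\<close>, of k] C(2) by (auto simp: s_def)
  define h where "h x = (\<Sum>k. u (s k) x * (1/2) ^ k)" for x
  define hN where "hN N x = (\<Sum>k<N. u (s k) x * (1/2) ^ k)" for N x
  have bd: "0 \<le> u (s k) x * (1/2) ^ k" "u (s k) x * (1/2) ^ k \<le> (1/2) ^ k" if "x \<in> topspace X" for k x
    using uK[OF s[of k]] that by (auto intro: mult_left_le_one_le)
  have sg: "summable (\<lambda>k. (1/2::real) ^ k)" by (rule summable_geometric) simp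
  have summ: "summable (\<lambda>k. u (s k) x * (1/2) ^ k)" if "x \<in> topspace X" for x
    using bd[OF that] by (intro summable_comparison_test'[OF sg, of 0]) auto
  have tail: "0 \<le> h x - hN N x \<and> h x - hN N x \<le> 2 * (1/2) ^ N" if x: "x \<in> topspace X" for x N
  proof -
    have "h x - hN N x = (\<Sum>k. u (s (k + N)) x * (1/2) ^ (k + N))"
      using suminf_split_initial_segment[OF summ[OF x], of N] by (simp add: h_def hN_def)
    moreover have s1: "summable (\<lambda>k. u (s (k + N)) x * (1/2) ^ (k + N))"
      using summ[OF x] by (rule summable_ignore_initial_segment)
    moreover have "(\<Sum>k. u (s (k + N)) x * (1/2) ^ (k + N)) \<le> (\<Sum>k. (1/2::real) ^ (k + N))"
      using bd[OF x] s1 summable_ignore_initial_segment[OF sg, of N] by (intro suminf_le) auto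
    moreover have "(\<Sum>k. (1/2::real) ^ (k + N)) = 2 * (1/2) ^ N"
      using suminf_geometric[of "1/2::real"] sg by (simp add: power_add suminf_mult2[symmetric])
    moreover have "0 \<le> (\<Sum>k. u (s (k + N)) x * (1/2) ^ (k + N))"
      using s1 bd[OF x] by (intro suminf_nonneg) auto
    ultimately show ?thesis by linarith
  qed
  have "continuous_map X euclideanreal h"
  proof (rule continuous_map_real_uniform_limit[where f = hN and \<eta> = "\<lambda>N. 2 * (1/2) ^ N"])
    show "continuous_map X euclideanreal (hN N)" for N
      unfolding hN_def using uK[OF s] by (intro continuous_map_sum continuous_map_real_mult_right) auto
    show "\<bar>hN N x - h x\<bar> \<le> 2 * (1/2) ^ N" if "x \<in> topspace X" for N x
      using tail[OF that, of N] by linarith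
    show "(\<lambda>N. 2 * (1/2::real) ^ N) \<longlonglongrightarrow> 0"
      by (rule tendsto_mult_right_zero) (rule LIMSEQ_power_zero, simp)
  qed
  moreover have hpos: "h x > 0" if x: "x \<in> topspace X" for x
  proof -
    obtain c where "c \<in> C" "x \<in> W c" using V(3) C(3) x by blast
    then obtain k where "u (s k) x > 0" using from_nat_into_surj[OF C(1)] by (auto simp: s_def W_def)
    then have "0 < u (s k) x * (1/2) ^ k" by simp
    then show ?thesis unfolding h_def using bd(1)[OF x] by (intro suminf_pos2[OF summ[OF x]]) auto
  qed
  ultimately have "continuous_map X euclideanreal (\<lambda>x. 1 / h x)"
    by (intro continuous_map_real_divide) force+
  moreover have "\<exists>K. compactin X K \<and> {x \<in> topspace X. 1 / h x \<le> r} \<subseteq> K" for r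
  proof -
    \<comment> \<open>\<open>max r 1\<close> covers values of \<open>r\<close> that are not
      positive. Off the first \<open>N\<close> compact sets \<open>h\<close> is at most
      \<open>2 * (1/2) ^ N\<close>, so \<open>1 / h\<close> exceeds \<open>r\<close> there.\<close>
    have "1 / (2 * max r 1) > 0" by (auto simp: max_def)
    then obtain N where N: "(1/2) ^ N < 1 / (2 * max r 1)" using real_arch_pow_inv[of "1 / (2 * max r 1)" "1/2"] by auto
    have "x \<in> (\<Union>k<N. K (s k))" if x: "x \<in> topspace X" "1 / h x \<le> r" for x
    proof (rule ccontr)
      assume "x \<notin> (\<Union>k<N. K (s k))"
      then have "hN N x = 0" unfolding hN_def using uK[OF s] x by (intro sum.neutral) auto
      then have "h x \<le> 2 * (1/2) ^ N" using tail[OF x(1), of N] by simp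
      also have "\<dots> < 1 / max r 1" using N by (simp add: field_simps)
      finally have "max r 1 * h x < 1" by (simp add: field_simps max_def split: if_splits)
      moreover have "1 \<le> r * h x" using x hpos[OF x(1)] by (simp add: field_simps)
      moreover have "r * h x \<le> max r 1 * h x" using hpos[OF x(1)] by (intro mult_right_mono) auto
      ultimately show False by linarith
    qed
    moreover have "compactin X (\<Union>k<N. K (s k))" using uK[OF s] by (intro compactin_Union) auto
    ultimately show ?thesis by blast
  qed
  ultimately show ?thesis by blast
qed

section \<open>The embedding as a limit of perturbations\<close>

text \<open>Each stage carries a map and a tolerance within which the separation of its own pair
  survives. A move is at most half the current tolerance, and tolerances are at least halved, so the
  limit is within tolerance of every stage and separates all pairs. Its coordinate 0 stays near the
  exhaustion function, which makes it proper.\<close>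

theorem closed_embedding_in_Euclidean_space:
  assumes lc: "locally_compact_space X" and H: "Hausdorff_space X" and sc: "second_countable X"
    and dim: "covering_dim_le X n"
  shows "\<exists>e. closed_embedding X (Euclidean_space (2 * n + 1)) e"
proof -
  define m where "m = 2 * n + 1"
  have "regular_space X" using lc H locally_compact_Hausdorff_imp_regular_space by blast
  then have nX: "normal_space X"
    using sc regular_Lindelof_imp_normal_space second_countable_imp_Lindelof_space by blast
  obtain P Q :: "nat \<Rightarrow> 'a set" where PQ: "\<forall>k. compactin X (P k) \<and> compactin X (Q k) \<and> P k \<inter> Q k = {}"
    and sep: "\<forall>x\<in>topspace X. \<forall>y\<in>topspace X. x \<noteq> y \<longrightarrow> (\<exists>k. x \<in> P k \<and> y \<in> Q k)"
    using separating_compact_pairs[OF lc H sc] by (elim exE conjE)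
  obtain g where g: "continuous_map X euclideanreal g"
    and gK: "\<forall>r. \<exists>K. compactin X K \<and> {x \<in> topspace X. g x \<le> r} \<subseteq> K"
    using exists_exhaustion_function[OF lc H sc] by (elim exE conjE)
  define cts where "cts f \<longleftrightarrow> (\<forall>i<m. continuous_map X euclideanreal (f i))" for f :: "nat \<Rightarrow> 'a \<Rightarrow> real"
  define close where "close f h \<eta> \<longleftrightarrow> (\<forall>i<m. \<forall>x\<in>topspace X. \<bar>h i x - f i x\<bar> \<le> \<eta>)" for f h :: "nat \<Rightarrow> 'a \<Rightarrow> real" and \<eta>
  define robust where "robust k f \<eta> \<longleftrightarrow> (\<forall>h. close f h \<eta> \<longrightarrow> (\<forall>x\<in>P k. \<forall>y\<in>Q k. \<exists>i<m. h i x \<noteq> h i y))"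
    for k f \<eta>
  have step: "\<exists>f' \<eta>'. cts f' \<and> 0 < \<eta>' \<and> \<eta>' \<le> \<epsilon> \<and> close f f' \<epsilon> \<and> robust k f' \<eta>'"
    if f: "cts f" and \<epsilon>: "\<epsilon> > 0" for f \<epsilon> k
  proof -
    have clP: "closedin X (P k)" "closedin X (Q k)" using PQ H compactin_imp_closedin by auto
    obtain f' where f': "\<forall>i<m. continuous_map X euclideanreal (f' i) \<and> (\<forall>x\<in>topspace X. \<bar>f' i x - f i x\<bar> \<le> \<epsilon>)"
      "\<forall>x\<in>P k. \<forall>y\<in>Q k. \<exists>i<m. f' i x \<noteq> f' i y"
      using perturb_to_separate[OF nX dim m_def _ _ clP(1) _ clP(2) _ \<epsilon>, of f] PQ f unfolding cts_def by auto
    obtain \<eta> where \<eta>: "\<eta> > 0"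
      "\<forall>h. (\<forall>i<m. \<forall>x\<in>topspace X. \<bar>h i x - f' i x\<bar> \<le> \<eta>) \<longrightarrow> (\<forall>x\<in>P k. \<forall>y\<in>Q k. \<exists>i<m. h i x \<noteq> h i y)"
      using separation_is_robust[of m X f' "P k" "Q k"] f' PQ by auto
    have "close f' h \<eta>" if "close f' h (min \<eta> \<epsilon>)" for h
      using that by (simp add: close_def)
    then have "robust k f' (min \<eta> \<epsilon>)"
      using \<eta>(2) unfolding robust_def close_def[of f' _ \<eta>] by blast
    moreover have "cts f'" "close f f' \<epsilon>" using f'(1) by (auto simp: cts_def close_def)
    ultimately show ?thesis using \<eta>(1) \<epsilon> by (intro exI[of _ f'] exI[of _ "min \<eta> \<epsilon>"]) auto
  qed
  \<comment> \<open>Coordinate 0 carries the exhaustion function; it exists because \<open>m\<close>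
    is positive.\<close>
  define f0 where "f0 i x = (if i = 0 then g x else 0)" for i :: nat and x
  have "cts f0" unfolding cts_def f0_def using g by auto
  \<comment> \<open>The state is a pair of map and tolerance; the clause for \<open>k = 0\<close>
    anchors the sequence at \<open>f0\<close>.\<close>
  define Inv where "Inv k s \<longleftrightarrow> cts (fst s) \<and> 0 < snd s \<and> snd s \<le> 1 \<and> robust k (fst s) (snd s) \<and> (k = 0 \<longrightarrow> close f0 (fst s) 1)" for k s
  have "\<exists>s. \<forall>k. Inv k (s k) \<and> (close (fst (s k)) (fst (s (Suc k))) (snd (s k) / 2) \<and> snd (s (Suc k)) \<le> snd (s k) / 2)"
  proof (rule dependent_nat_choice)
    obtain f' \<eta>' where "cts f'" "0 < \<eta>'" "\<eta>' \<le> 1" "close f0 f' 1" "robust 0 f' \<eta>'"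
      using step[OF \<open>cts f0\<close>, of 1 0] by auto
    then show "\<exists>s. Inv 0 s" unfolding Inv_def by (intro exI[of _ "(f', \<eta>')"]) simp
  next
    fix s k assume s: "Inv k s"
    then have "cts (fst s)" "snd s / 2 > 0" "snd s / 2 \<le> 1" by (auto simp: Inv_def)
    then obtain f' \<eta>' where "cts f'" "0 < \<eta>'" "\<eta>' \<le> snd s / 2" "close (fst s) f' (snd s / 2)" "robust (Suc k) f' \<eta>'"
      using step[of "fst s" "snd s / 2" "Suc k"] by auto
    then show "\<exists>t. Inv (Suc k) t \<and> close (fst s) (fst t) (snd s / 2) \<and> snd t \<le> snd s / 2"
      using \<open>snd s / 2 \<le> 1\<close> unfolding Inv_def by (intro exI[of _ "(f', \<eta>')"]) simp
  qed
  then obtain s where Inv: "\<And>k. Inv k (s k)"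
    and s1: "\<And>k. close (fst (s k)) (fst (s (Suc k))) (snd (s k) / 2)" and s2: "\<And>k. snd (s (Suc k)) \<le> snd (s k) / 2"
    by blast
  define f where "f k = fst (s k)" for k
  define \<eta> where "\<eta> k = snd (s k)" for k
  have \<eta>0: "0 < \<eta> k" for k using Inv[of k] by (simp add: Inv_def \<eta>_def)
  \<comment> \<open>The k-th move is at most \<open>\<eta> k / 2\<close>, hence at most
    \<open>\<eta> k - \<eta> (Suc k)\<close>, so the bounds telescope.\<close>
  have diff: "\<bar>f (k + j) i x - f k i x\<bar> \<le> \<eta> k - \<eta> (k + j)" if "i < m" "x \<in> topspace X" for k j i x
  proof (induction j)
    case (Suc j)
    have "\<bar>f (Suc (k + j)) i x - f (k + j) i x\<bar> \<le> \<eta> (k + j) / 2" "\<eta> (Suc (k + j)) \<le> \<eta> (k + j) / 2"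
      using s1[of "k + j"] s2[of "k + j"] that by (auto simp: close_def f_def \<eta>_def)
    then have "\<bar>f (Suc (k + j)) i x - f k i x\<bar> \<le> \<eta> k - \<eta> (Suc (k + j))" using Suc by linarith
    then show ?case by simp
  qed simp
  have \<eta>le: "\<eta> k \<le> (1/2) ^ k" for k
  proof (induction k)
    case 0
    then show ?case using Inv[of 0] by (simp add: Inv_def \<eta>_def)
  next
    case (Suc k)
    then show ?case using s2[of k] by (simp add: \<eta>_def)
  qed
  have \<eta>lim: "\<eta> \<longlonglongrightarrow> 0"
  proof (rule tendsto_sandwich[of "\<lambda>_. 0" _ _ "\<lambda>k. (1/2) ^ k"])
    show "(\<lambda>k. (1/2::real) ^ k) \<longlonglongrightarrow> 0" by (rule LIMSEQ_power_zero) simp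
  qed (use \<eta>0 \<eta>le in \<open>auto intro: always_eventually less_imp_le\<close>)
  define F where "F i x = lim (\<lambda>k. f k i x)" for i x
  have F: "\<bar>F i x - f k i x\<bar> \<le> \<eta> k" if ix: "i < m" "x \<in> topspace X" for k i x
  proof -
    have "Cauchy (\<lambda>k. f k i x)"
    proof (rule metric_CauchyI)
      fix \<epsilon> :: real assume "\<epsilon> > 0"
      then obtain N where N: "\<eta> N < \<epsilon> / 2"
        using order_tendstoD(2)[OF \<eta>lim, of "\<epsilon> / 2"] by (auto simp: eventually_sequentially)
      have "\<bar>f k i x - f N i x\<bar> < \<epsilon> / 2" if "k \<ge> N" for k
        using diff[OF ix, of N "k - N"] \<eta>0[of k] N that by simp
      then have "dist (f k i x) (f l i x) < \<epsilon>" if "k \<ge> N" "l \<ge> N" for k l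
        using that unfolding dist_real_def by (smt (verit) field_sum_of_halves)
      then show "\<exists>N. \<forall>k\<ge>N. \<forall>l\<ge>N. dist (f k i x) (f l i x) < \<epsilon>" by blast
    qed
    then have "(\<lambda>k. f k i x) \<longlonglongrightarrow> F i x"
      unfolding F_def using Cauchy_convergent convergent_LIMSEQ_iff by blast
    then have "(\<lambda>j. f (k + j) i x) \<longlonglongrightarrow> F i x"
      using LIMSEQ_ignore_initial_segment[of "\<lambda>k. f k i x" "F i x" k] by (simp add: add.commute)
    then have "(\<lambda>j. \<bar>f (k + j) i x - f k i x\<bar>) \<longlonglongrightarrow> \<bar>F i x - f k i x\<bar>"
      by (intro tendsto_rabs tendsto_diff tendsto_const)
    moreover have "\<bar>f (k + j) i x - f k i x\<bar> \<le> \<eta> k" for j using diff[OF ix, of k j] \<eta>0[of "k + j"] by linarith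
    ultimately show ?thesis by (intro LIMSEQ_le_const2) auto
  qed
  have cF: "continuous_map X euclideanreal (F i)" if "i < m" for i
  proof (rule continuous_map_real_uniform_limit[where f = "\<lambda>k. f k i" and \<eta> = \<eta>])
    show "continuous_map X euclideanreal (f k i)" for k
      using Inv[of k] that by (simp add: Inv_def cts_def f_def)
    show "\<bar>f k i x - F i x\<bar> \<le> \<eta> k" if "x \<in> topspace X" for k x
      using F[OF \<open>i < m\<close> that, of k] by (simp add: abs_minus_commute)
  qed (rule \<eta>lim)
  have inj: "\<exists>i<m. F i x \<noteq> F i y" if xy: "x \<in> topspace X" "y \<in> topspace X" "x \<noteq> y" for x y
  proof -
    obtain k where k: "x \<in> P k" "y \<in> Q k" using sep xy by blast
    have "close (f k) F (\<eta> k)" using F by (simp add: close_def)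
    moreover have "robust k (f k) (\<eta> k)" using Inv[of k] by (simp add: Inv_def f_def \<eta>_def)
    ultimately show ?thesis using k unfolding robust_def by blast
  qed
  \<comment> \<open>At most 1 is lost from \<open>f0\<close> to the first map, and at most
    \<open>\<eta> 0 \<le> 1\<close> from there to the limit.\<close>
  have Fg: "\<bar>F 0 x - g x\<bar> \<le> 2" if x: "x \<in> topspace X" for x
  proof -
    have "0 < m" by (simp add: m_def)
    then have "\<bar>F 0 x - f 0 0 x\<bar> \<le> \<eta> 0" "\<bar>f 0 0 x - g x\<bar> \<le> 1"
      using F[OF _ x, of 0 0] Inv[of 0] x by (auto simp: Inv_def close_def f_def f0_def)
    then show ?thesis using \<eta>le[of 0] by simp
  qed
  let ?E = "Euclidean_space m"
  define e where "e = (\<lambda>x i. if i < m then F i x else 0)"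
  have ce: "continuous_map X ?E e"
    unfolding e_def continuous_map_componentwise_Euclidean_space using cF by simp
  \<comment> \<open>A compact \<open>C\<close> bounds coordinate 0, hence \<open>g\<close>, on its
    preimage, which is thus a closed subset of a compact set.\<close>
  have "proper_map X ?E e"
  proof (rule compact_imp_proper_map)
    show "k_space ?E" by (intro metrizable_imp_k_space metrizable_Euclidean_space)
    show "kc_space ?E" by (intro Hausdorff_imp_kc_space Hausdorff_Euclidean_space)
    show "e \<in> topspace X \<rightarrow> topspace ?E" using ce by (simp add: continuous_map_def)
    fix C assume C: "compactin ?E C"
    have "compactin euclideanreal ((\<lambda>x. x 0) ` C)"
      using image_compactin[OF C continuous_map_Euclidean_coordinate] by simp
    then have "bounded ((\<lambda>x. x 0) ` C)" by (simp add: compact_imp_bounded)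
    then obtain b where b: "\<forall>z\<in>C. \<bar>z 0\<bar> \<le> b" unfolding bounded_iff by auto
    obtain K where K: "compactin X K" "{x \<in> topspace X. g x \<le> b + 2} \<subseteq> K" using gK by blast
    have "{x \<in> topspace X. e x \<in> C} \<subseteq> K"
    proof
      fix x assume x: "x \<in> {x \<in> topspace X. e x \<in> C}"
      then have "\<bar>F 0 x\<bar> \<le> b" using b by (force simp: e_def m_def)
      then have "g x \<le> b + 2" using Fg[of x] x by auto
      then show "x \<in> K" using K x by auto
    qed
    moreover have "closedin X {x \<in> topspace X. e x \<in> C}"
      using C Hausdorff_Euclidean_space compactin_imp_closedin by (intro closedin_continuous_map_preimage[OF ce]) blast
    ultimately show "compactin X {x \<in> topspace X. e x \<in> C}" using K(1) closed_compactin by blast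
  qed (use ce in simp)
  then have clo: "closed_map X ?E e" by (rule proper_imp_closed_map)
  have "inj_on e (topspace X)"
  proof (rule inj_onI, rule ccontr)
    fix x y assume xy: "x \<in> topspace X" "y \<in> topspace X" "e x = e y" "x \<noteq> y"
    then obtain i where "i < m" "F i x \<noteq> F i y" using inj by blast
    then have "e x i \<noteq> e y i" by (simp add: e_def)
    then show False using xy(3) by simp
  qed
  then have "embedding_map X ?E e" by (intro injective_closed_imp_embedding_map ce clo)
  moreover have "closedin ?E (e ` topspace X)" using clo unfolding closed_map_def by blast
  ultimately show ?thesis unfolding closed_embedding_def m_def by blast
qed

section \<open>The equivalence of the three conditions\<close>

text \<open>All implications pass through \<open>emb\<close>. The last conjunct justifies the
  universe \<open>nat \<Rightarrow> real\<close>: \<open>grp\<close> is proved for groups on an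
  arbitrary type and used at both types.\<close>

theorem corollary1p3:
  fixes X :: "'a topology"
  assumes "cosmic_space X" "finite_dimensional X" "locally_continuum_connected X"
  shows
    "(closed_embeds_in_cfd_group TYPE(nat \<Rightarrow> real) X \<longleftrightarrow>
      (\<exists>e. closed_embedding X (Euclidean_space (2 * the_enat (covering_dim X) + 1)) e)) \<and>
     ((\<exists>e. closed_embedding X (Euclidean_space (2 * the_enat (covering_dim X) + 1)) e) \<longleftrightarrow>
      metrizable_space X \<and> locally_compact_space X) \<and>
     (closed_embeds_in_cfd_group TYPE('g) X \<longrightarrow>
      closed_embeds_in_cfd_group TYPE(nat \<Rightarrow> real) X)"
proof -
  define n where "n = the_enat (covering_dim X)"
  define emb where "emb \<longleftrightarrow> (\<exists>e. closed_embedding X (Euclidean_space (2 * n + 1)) e)"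
  \<comment> \<open>Finiteness makes \<open>the_enat\<close> return the dimension itself.\<close>
  obtain N where "covering_dim X = enat N" using assms(2) unfolding finite_dimensional_def by (metis less_infinityE)
  then have dim: "covering_dim_le X n" by (intro covering_dim_leD) (simp add: n_def)
  obtain \<N> where N: "countable \<N>" "network X \<N>"
    using cosmic_space_countable_network[OF assms(1)] by (elim exE conjE)
  \<comment> \<open>Cosmic spaces are not assumed T1 here, so Hausdorffness is supplied by the
    conditions themselves: by the group in the first, by metrizability in the third.\<close>
  have lcH: "emb" if "locally_compact_space X" "Hausdorff_space X"
    unfolding emb_def
    using closed_embedding_in_Euclidean_space[OF that locally_compact_network_imp_second_countable[OF that N] dim] .
  have homeo: "X homeomorphic_space subtopology T (e ` topspace X) \<and> closedin T (e ` topspace X)"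
    if "closed_embedding X T e" for T :: "'b topology" and e
    using that embedding_map_imp_homeomorphic_space by (auto simp: closed_embedding_def)
  have grp: "emb" if "closed_embedding X T e" "topological_group G T" "compactly_finite_dimensional T"
    for G :: "'b monoid" and T e
  proof (rule lcH)
    show "locally_compact_space X"
      using that(2,3,1) assms(3) by (rule closed_embedding_imp_locally_compact)
    have "Hausdorff_space T" using that(2) by (simp add: topological_group_def)
    then show "Hausdorff_space X"
      using homeo[OF that(1)] homeomorphic_Hausdorff_space Hausdorff_space_subtopology by metis
  qed
  have "metrizable_space X \<and> locally_compact_space X" if E: emb
  proof -
    obtain e where e: "closed_embedding X (Euclidean_space (2 * n + 1)) e" using E by (auto simp: emb_def)
    then show ?thesis
      using homeo[OF e] homeomorphic_metrizable_space metrizable_space_subtopology metrizable_Euclidean_space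
        homeomorphic_locally_compact_space locally_compact_space_closed_subset locally_compact_Euclidean_space by metis
  qed
  moreover have emb if "metrizable_space X \<and> locally_compact_space X"
    using that lcH metrizable_imp_Hausdorff_space by blast
  moreover have "closed_embeds_in_cfd_group TYPE(nat \<Rightarrow> real) X" if emb
    using that topological_group_Euclidean compactly_finite_dimensional_Euclidean
    unfolding emb_def closed_embeds_in_cfd_group_def by blast
  moreover have emb if "closed_embeds_in_cfd_group TYPE(nat \<Rightarrow> real) X"
    using that grp unfolding closed_embeds_in_cfd_group_def by blast
  moreover have emb if "closed_embeds_in_cfd_group TYPE('g) X"
    using that grp unfolding closed_embeds_in_cfd_group_def by blast
  ultimately show ?thesis unfolding emb_def n_def by blast
qed

end
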